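(* Let $\mu,\nu\in\mathcal P(\mathbb R)$ with $\mu\le_{\rm cx}\nu$ and $\nu$ atomless. If $c:\mathbb R^2\to\mathbb R$ is continuous with $|c(x,y)|\le a(x)+b(y)$ for some $a\in L^1(\mu)$ and $b\in L^1(\nu)$, then $$\inf_{\pi\in\mathcal M_M(\mu,\nu)}\int_{\mathbb R\times\mathbb R}c(x,y)\,\pi(dx,dy)=\inf_{\pi\in\mathcal M(\mu,\nu)}\int_{\mathbb R\times\mathbb R}c(x,y)\,\pi(dx,dy).$$
   Context: $\mathcal P(\mathbb R)$ is the set of Borel probability measures on $\mathbb R$ with finite first moment. $\mu\le_{\rm cx}\nu$ means $\int\phi\,d\mu\le\int\phi\,d\nu$ for every convex $\phi:\mathbb R\to\mathbb R$. $\mathcal M(\mu,\nu)$ is the set of martingale transports: laws $\pi$ on $\mathbb R^2$ of random vectors $(X,Y)$ with $X\sim\mu$, $Y\sim\nu$, $\mathbb E[Y|X]=X$ a.s. $\mathcal M_M(\mu,\nu)$ is the subset of those $\pi$ of the form $\pi=(f,\mathrm{id}_{\mathbb R})_{\#}\nu$ for some Borel $f:\mathbb R\to\mathbb R$ (i.e. $X=f(Y)$ a.s.). *)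

theory Defs
  imports "HOL-Probability.Probability"
begin

definition borel_prob_fm :: "real measure set" where
  "borel_prob_fm = {\<mu>. prob_space \<mu> \<and> sets \<mu> = sets borel \<and> integrable \<mu> (\<lambda>x. x)}"

text \<open>The integral with values in the extended reals. The Bochner integral of a non-integrable
  function is 0, which would be wrong for a convex function whose integral is \<open>\<infinity>\<close>.
  If \<open>M\<close> has a finite first moment and \<open>f\<close> is convex, then \<open>f\<close> has an affine minorant, so the
  subtrahend is finite and no difference \<open>\<infinity> - \<infinity>\<close> arises. Note that \<open>ennreal\<close> truncates
  negative values to 0.\<close>

definition ext_integral :: "'a measure \<Rightarrow> ('a \<Rightarrow> real) \<Rightarrow> ereal" where
  "ext_integral M f =
     enn2ereal (\<integral>\<^sup>+x. ennreal (f x) \<partial>M) - enn2ereal (\<integral>\<^sup>+x. ennreal (- f x) \<partial>M)"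

definition convex_order :: "real measure \<Rightarrow> real measure \<Rightarrow> bool" (infix "\<le>\<^sub>c\<^sub>x" 50) where
  "\<mu> \<le>\<^sub>c\<^sub>x \<nu> \<longleftrightarrow> (\<forall>\<phi>. convex_on UNIV \<phi> \<longrightarrow> ext_integral \<mu> \<phi> \<le> ext_integral \<nu> \<phi>)"

definition atomless :: "real measure \<Rightarrow> bool" where
  "atomless \<nu> \<longleftrightarrow> (\<forall>x. emeasure \<nu> {x} = 0)"

text \<open>The random vector \<open>(X, Y)\<close> with law \<open>\<pi>\<close> is realised canonically, as \<open>(fst, snd)\<close> on the
  probability space \<open>\<pi>\<close> itself; \<open>vimage_algebra (space \<pi>) fst borel\<close> is the sigma-algebra
  generated by \<open>X\<close>.\<close>

definition martingale_transports ::
    "real measure \<Rightarrow> real measure \<Rightarrow> (real \<times> real) measure set" where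
  "martingale_transports \<mu> \<nu> =
     {\<pi>. prob_space \<pi> \<and> sets \<pi> = sets borel \<and>
         distr \<pi> borel fst = \<mu> \<and> distr \<pi> borel snd = \<nu> \<and>
         (AE z in \<pi>. real_cond_exp \<pi> (vimage_algebra (space \<pi>) fst borel) snd z = fst z)}"

definition monge_martingale_transports ::
    "real measure \<Rightarrow> real measure \<Rightarrow> (real \<times> real) measure set" where
  "monge_martingale_transports \<mu> \<nu> =
     {\<pi> \<in> martingale_transports \<mu> \<nu>.
        \<exists>f \<in> borel_measurable borel. \<pi> = distr \<nu> borel (\<lambda>y. (f y, y))}"

end

theory Submission
  imports Defs
begin

text \<open>
  Every Monge transport is a martingale transport, so it suffices to approximate the cost of a given
  martingale transport \<open>\<pi>\<close> by Monge transports. As the cost is continuous and dominated by functions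
  of the marginals, it is enough to find, for a finite partition of the line into intervals
  \<open>I\<^sub>i\<close>, a Monge transport that gives every rectangle \<open>I\<^sub>i \<times> I\<^sub>j\<close> the same mass as \<open>\<pi>\<close>.

  Let \<open>h\<^sub>i\<close> be the density with respect to \<open>\<nu>\<close> of the second marginal of \<open>\<pi>\<close> restricted to
  \<open>I\<^sub>i \<times> \<real>\<close>. The functions \<open>h\<^sub>i\<close> are replaced by indicators of disjoint sets \<open>B\<^sub>i\<close>, preserving mass and
  mean on each \<open>I\<^sub>j\<close>, and so that the mass in \<open>I\<^sub>i\<close> itself becomes more spread out. This keeps \<open>\<mu>\<close>
  restricted to \<open>I\<^sub>i\<close> below \<open>\<nu>\<close> restricted to \<open>B\<^sub>i\<close> in convex order. It is done for two densities
  \<open>h\<^sub>i\<close>, \<open>h\<^sub>j\<close> at a time: on each cell one of them becomes an interval and the other its complement.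

  It remains to transport an atomless measure backwards by a map to a measure below it in convex
  order. Cutting the smaller measure at a threshold \<open>t\<close>, the larger one splits accordingly, the
  left part being restricted to a set of the form \<open>{..\<alpha>} \<union> {t<..\<gamma>}\<close>. Doing this successively for all
  rational thresholds determines the map, and the equality of means of all pieces is the martingale
  property.
\<close>

section \<open>Level sets of the distribution function\<close>

text \<open>Equal rectangle masses alone would not suffice: each piece of \<nu> must still be
  reachable from its piece of \<mu> by a martingale, so the convex order has to survive the passage
  from densities to sets. Only one cell endangers it. If the strike \<open>k\<close> of a call lies
  between points of cell i, the call is affine on every other cell, where mass and mean decide;
  otherwise Jensen's inequality decides. So label i makes a demand in cell i only, and the demands
  of different labels never meet in one cell. In a given cell the sum of two densities is fixed,
  hence contracting one spreads the other; contracting is possible because, among densities between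
  0 and 1 of given mass and mean, some interval is least in convex order. Atomlessness enters
  through mass coordinates: windows of prescribed mass exist and their means vary continuously, so
  intermediate values supply both the interval and the set in a threshold split. The split yields
  sets, never densities; therefore successive pieces share no mass and the limit is a map.\<close>

lemma closed_down_closed_cases:
  fixes A :: "real set"
  assumes "closed A" and down: "\<And>x y. y \<in> A \<Longrightarrow> x \<le> y \<Longrightarrow> x \<in> A"
  shows "A = {} \<or> A = UNIV \<or> (\<exists>a. A = {..a})"
proof (cases "A = {} \<or> A = UNIV")
  case False
  then obtain z where "z \<notin> A" "A \<noteq> {}" by auto
  have "bdd_above A"
    using down \<open>z \<notin> A\<close> by (intro bdd_aboveI[of _ z]) (metis linorder_le_cases)
  then have "Sup A \<in> A"
    using closed_contains_Sup \<open>closed A\<close> \<open>A \<noteq> {}\<close> by blast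
  then have "A = {..Sup A}"
    using down cSup_upper[OF _ \<open>bdd_above A\<close>] by auto
  then show ?thesis by blast
qed blast

locale finite_mean_measure = finite_borel_measure +
  assumes integrable_id: "integrable M (\<lambda>x. x)"
begin

lemma space_UNIV [simp]: "space M = UNIV"
  by (rule borel_UNIV)

lemma sets_borel [simp, measurable_cong]: "sets M = sets borel"
  by (rule M_is_borel)

lemma integrable_affine: "integrable M (\<lambda>x. c + d * x)"
  using integrable_id by auto

lemma integrable_call: "integrable M (\<lambda>x. max 0 (x - k))"
  using integrable_id by auto

lemma integrable_put: "integrable M (\<lambda>x. max 0 (k - x))"
  using integrable_id by auto

lemma set_integrable:
  fixes f :: "real \<Rightarrow> real"
  assumes "integrable M f" "A \<in> sets borel"
  shows "set_integrable M A f"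
  unfolding set_integrable_def using assms by (intro integrable_mult_indicator) auto

lemma set_integral_affine:
  assumes "A \<in> sets borel"
  shows "(LINT x:A|M. c + d * x) = c * measure M A + d * (LINT x:A|M. x)"
proof -
  have "(LINT x:A|M. c + d * x) = (LINT x:A|M. c) + (LINT x:A|M. d * x)"
    using assms integrable_id by (intro set_integral_add set_integrable) auto
  then show ?thesis
    using assms by (simp add: set_integral_const emeasure_finite)
qed

lemma set_integral_UNIV: "(LINT x:UNIV|M. f x) = integral\<^sup>L M (f :: real \<Rightarrow> real)"
  by (simp add: set_lebesgue_integral_def)

lemma set_integral_null:
  fixes f :: "real \<Rightarrow> real"
  assumes "A \<in> sets borel" "measure M A = 0"
  shows "(LINT x:A|M. f x) = 0"
proof -
  have "A \<in> null_sets M"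
    using assms by (auto simp: null_sets_def emeasure_eq_measure)
  then have "AE x in M. x \<notin> A"
    by (rule AE_not_in)
  then show ?thesis
    unfolding set_lebesgue_integral_def by (intro integral_eq_zero_AE) auto
qed

end

text \<open>The distribution function of an atomless measure serves as a coordinate: the sets
  \<open>{x. cdf M x \<le> s}\<close> are half-lines of mass exactly \<open>s\<close>, even where the distribution function is
  not injective.\<close>

locale atomless_mean_measure = finite_mean_measure +
  assumes no_atoms: "\<And>x. measure M {x} = 0"
begin

definition lower :: "real \<Rightarrow> real set" where
  "lower s = {x. cdf M x \<le> s}"

definition lower_moment :: "real \<Rightarrow> real" where
  "lower_moment s = (LINT x:lower s|M. x)"

lemma continuous_cdf: "continuous_on UNIV (cdf M)"
  using isCont_cdf no_atoms by (auto intro: continuous_at_imp_continuous_on)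

lemma closed_lower: "closed (lower s)"
  unfolding lower_def using continuous_cdf by (intro closed_Collect_le continuous_on_const) auto

lemma lower_borel [measurable, simp]: "lower s \<in> sets borel"
  using closed_lower by auto

lemma lower_mono: "s \<le> s' \<Longrightarrow> lower s \<subseteq> lower s'"
  unfolding lower_def by auto

lemma lower_cases: 
  obtains "lower s = {}" | "lower s = UNIV" | a where "lower s = {..a}"
proof -
  have "lower s = {} \<or> lower s = UNIV \<or> (\<exists>a. lower s = {..a})"
    using cdf_nondecreasing
    by (intro closed_down_closed_cases closed_lower) (auto simp: lower_def intro: order_trans)
  then show ?thesis using that by blast
qed

text \<open>Closedness makes \<open>lower s\<close> a closed half-line whose endpoint
  \<open>a\<close> satisfies \<open>cdf M a \<le> s\<close>; right continuity gives the converse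
  inequality. In the degenerate cases the limits of the distribution function at the two infinities
  force \<open>s\<close> to be 0 or the total mass.\<close>

lemma measure_lower:
  assumes "0 \<le> s" "s \<le> measure M UNIV"
  shows "measure M (lower s) = s"
proof (cases rule: lower_cases[of s])
  case 1
  then have "\<And>x. s \<le> cdf M x" by (auto simp: lower_def not_le intro: less_imp_le)
  then have "s \<le> 0"
    using tendsto_lowerbound[OF cdf_lim_at_bot] by auto
  then show ?thesis using 1 assms by simp
next
  case 2
  then have "\<And>x. cdf M x \<le> s" by (auto simp: lower_def)
  then have "measure M UNIV \<le> s"
    using tendsto_upperbound[OF cdf_lim_at_top] by auto
  then show ?thesis using 2 assms by simp
next
  case (3 a)
  have "\<And>x. a < x \<Longrightarrow> s \<le> cdf M x"
    using 3 unfolding lower_def by (metis atMost_iff leD le_cases mem_Collect_eq)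
  then have "s \<le> cdf M a"
    using tendsto_lowerbound[OF cdf_is_right_cont[unfolded continuous_within]]
    by (metis eventually_at_right_less eventually_mono trivial_limit_at_right_real)
  moreover have "cdf M a \<le> s" using 3 by (auto simp: lower_def)
  ultimately show ?thesis using 3 by (simp add: cdf_def)
qed

lemma measure_lower_diff:
  assumes "0 \<le> s" "s \<le> s'" "s' \<le> measure M UNIV"
  shows "measure M (lower s' - lower s) = s' - s"
  using assms finite_measure_Diff[of "lower s'" "lower s"] by (simp add: measure_lower lower_mono)

text \<open>A level set can be a whole interval, but for \<open>s > 0\<close> it sits in the windows
  \<open>lower s - lower (s - e)\<close> of mass \<open>e\<close>. Its nullity is what makes
  \<open>lower_moment\<close> continuous.\<close>

lemma measure_level:
  assumes "0 \<le> s" "s \<le> measure M UNIV"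
  shows "measure M {x. cdf M x = s} = 0"
proof (cases "s = 0")
  case True
  have "measure M {x. cdf M x = s} \<le> measure M (lower 0)"
    using lower_borel[of 0] by (intro finite_measure_mono) (auto simp: lower_def True)
  then show ?thesis using measure_lower[of 0] assms True
    by (simp add: measure_le_0_iff)
next
  case False
  have le: "measure M {x. cdf M x = s} \<le> e" if "0 < e" "e \<le> s" for e
  proof -
    have "measure M {x. cdf M x = s} \<le> measure M (lower s - lower (s - e))"
      using that by (intro finite_measure_mono) (simp_all, auto simp: lower_def)
    also have "\<dots> = e"
      using that assms by (subst measure_lower_diff) auto
    finally show ?thesis .
  qed
  have "measure M {x. cdf M x = s} \<le> 0"
  proof (rule field_le_epsilon)
    fix e :: real assume "0 < e"
    then show "measure M {x. cdf M x = s} \<le> 0 + e"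
      using le[of "min e s"] False assms by auto
  qed
  then show ?thesis by (simp add: measure_le_0_iff)
qed

text \<open>Off the null set where the distribution function equals \<open>s\<close>, the indicators
  of \<open>lower (u n)\<close> are eventually constant, so dominated convergence applies.\<close>

lemma lower_moment_continuous: "continuous_on {0..measure M UNIV} lower_moment"
  unfolding continuous_on_sequentially
proof (intro allI ballI impI; elim conjE)
  fix u :: "nat \<Rightarrow> real" and s
  assume s: "s \<in> {0..measure M UNIV}" and "\<forall>n. u n \<in> {0..measure M UNIV}" and u: "u \<longlonglongrightarrow> s"
  have "{x. cdf M x = s} \<in> sets M"
    using continuous_cdf by (auto intro!: borel_closed closed_Collect_eq)
  then have "AE x in M. x \<notin> {x. cdf M x = s}"
    using s measure_level[of s] by (intro AE_not_in) (auto simp: null_sets_def emeasure_eq_measure)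
  then have lim: "AE x in M. (\<lambda>n. indicat_real (lower (u n)) x *\<^sub>R x) \<longlonglongrightarrow> indicat_real (lower s) x *\<^sub>R x"
  proof eventually_elim
    case (elim x)
    then consider "cdf M x < s" | "s < cdf M x" by fastforce
    then have "\<forall>\<^sub>F n in sequentially. indicat_real (lower (u n)) x = indicat_real (lower s) x"
    proof cases
      case 1
      with order_tendstoD(1)[OF u 1] show ?thesis
        by (auto simp: lower_def indicator_def elim!: eventually_mono)
    next
      case 2
      with order_tendstoD(2)[OF u 2] show ?thesis
        by (auto simp: lower_def indicator_def elim!: eventually_mono)
    qed
    then show ?case
      by (intro tendsto_eventually) (auto elim: eventually_mono)
  qed
  show "(lower_moment \<circ> u) \<longlonglongrightarrow> lower_moment s"
    unfolding lower_moment_def set_lebesgue_integral_def comp_def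
  proof (rule integral_dominated_convergence[OF _ _ _ lim])
    show "integrable M (\<lambda>x. \<bar>x\<bar>)" using integrable_id by auto
  qed (auto simp: indicator_def)
qed

lemma lower_moment_0: "lower_moment 0 = 0"
  unfolding lower_moment_def by (intro set_integral_null) (auto simp: measure_lower)

lemma lower_moment_diff:
  assumes "s \<le> s'"
  shows "(LINT x:lower s' - lower s|M. x) = lower_moment s' - lower_moment s"
proof -
  have "lower s' = (lower s' - lower s) \<union> lower s"
    using lower_mono[OF assms] by auto
  then have "lower_moment s' = (LINT x:(lower s' - lower s) \<union> lower s|M. x)"
    by (simp add: lower_moment_def)
  also have "\<dots> = (LINT x:lower s' - lower s|M. x) + lower_moment s"
    unfolding lower_moment_def by (intro set_integral_Un set_integrable integrable_id) auto
  finally show ?thesis by simp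
qed

end

section \<open>Selecting an interval with prescribed mass and mean\<close>

text \<open>The affine function is the chord of the call over the ends of \<open>E\<close>, with
  slope 0 for a lower and slope 1 for an upper half-line. It serves as a Lagrange multiplier: call
  minus chord has exactly the signs that \<open>bathtub\<close> asks for. For the whole line no such
  function exists, hence its absence from the hypothesis.\<close>

lemma call_separation:
  fixes k :: real
  assumes "E = {} \<or> (\<exists>b. E = {..b}) \<or> (\<exists>a b. E = {..b} - {..a}) \<or> (\<exists>a. E = - {..a})"
  shows "\<exists>c d. (\<forall>y\<in>E. max 0 (y - k) \<le> c + d * y) \<and> (\<forall>y\<in>-E. c + d * y \<le> max 0 (y - k))"
  using assms
proof (elim disjE exE)
  fix b assume "E = {..b}"
  then show ?thesis by (intro exI[of _ "max 0 (b - k)"] exI[of _ 0]) auto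
next
  fix a assume "E = - {..a}"
  then show ?thesis by (intro exI[of _ "max 0 (a - k) - a"] exI[of _ 1]) (auto simp: max_def)
next
  assume "E = {}"
  then show ?thesis by (intro exI[of _ 0]) auto
next
  fix a b assume E: "E = {..b} - {..a}"
  show ?thesis
  proof (cases "a < b")
    case False
    with E show ?thesis by (intro exI[of _ 0]) auto
  next
    case True
    define p where "p x = max 0 (x - k)" for x :: real
    define d where "d = (p b - p a) / (b - a)"
    have d: "p b = p a + d * (b - a)" "0 \<le> d" "d \<le> 1"
      using True by (auto simp: d_def p_def field_simps max_def)
    have "p y \<le> p a + d * (y - a)" if "a < y" "y \<le> b" for y
    proof -
      have "0 \<le> p a + d * (y - a)"
        using that d(2) by (auto simp: p_def)
      moreover have "y - k \<le> p a + d * (y - a)"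
      proof -
        have "p a + d * (y - a) = p b - d * (b - y)"
          by (simp add: d(1) algebra_simps)
        moreover have "d * (b - y) \<le> 1 * (b - y)"
          using that d(3) by (intro mult_right_mono) auto
        ultimately show ?thesis by (simp add: p_def)
      qed
      ultimately show ?thesis by (simp add: p_def)
    qed
    moreover have "p a + d * (y - a) \<le> p y" if "y \<le> a" for y
    proof (cases "p a = 0")
      case True
      moreover have "d * (y - a) \<le> 0"
        using that d(2) by (intro mult_nonneg_nonpos) auto
      ultimately show ?thesis by (simp add: p_def)
    next
      case False
      then have "p a = a - k" "p b = b - k"
        using \<open>a < b\<close> by (auto simp: p_def max_def split: if_splits)
      then have "d = 1" using True by (simp add: d_def)
      then show ?thesis using \<open>p a = a - k\<close> by (simp add: p_def)
    qed
    moreover have "p a + d * (y - a) \<le> p y" if "b < y" for y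
    proof (cases "p b = 0")
      case bz: True
      then have "p a = 0" using True by (auto simp: p_def max_def split: if_splits)
      then have "d = 0" using bz True by (simp add: d_def)
      then show ?thesis using \<open>p a = 0\<close> by (simp add: p_def)
    next
      case False
      then have "p b = b - k" by (auto simp: p_def)
      moreover have "p a + d * (y - a) = p b + d * (y - b)"
        by (simp add: d(1) algebra_simps)
      moreover have "d * (y - b) \<le> 1 * (y - b)"
        using that d(3) by (intro mult_right_mono) auto
      ultimately show ?thesis by (simp add: p_def)
    qed
    moreover have line: "p a - d * a + d * y = p a + d * (y - a)" for y
      by (simp add: algebra_simps)
    ultimately show ?thesis
      unfolding E p_def[symmetric]
      by (intro exI[of _ "p a - d * a"] exI[of _ d]) (auto simp: line not_le)
  qed
qed

section \<open>Integrals against densities between 0 and 1\<close>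

context finite_mean_measure
begin

lemma weighted_integrable:
  fixes r f :: "real \<Rightarrow> real"
  assumes "r \<in> borel_measurable borel" "\<And>x. 0 \<le> r x" "\<And>x. r x \<le> 1" "integrable M f"
  shows "integrable M (\<lambda>x. r x * f x)"
proof (rule Bochner_Integration.integrable_bound[OF \<open>integrable M f\<close>])
  show "AE x in M. norm (r x * f x) \<le> norm (f x)"
    using assms(2,3) by (auto simp: abs_mult mult_left_le_one_le)
qed (use assms in auto)

lemma weight_integrable:
  assumes "r \<in> borel_measurable borel" "\<And>x. 0 \<le> r x" "\<And>x. r x \<le> (1::real)"
  shows "integrable M r"
  using weighted_integrable[OF assms, of "\<lambda>_. 1"] by simp

lemma weighted_affine:
  fixes r :: "real \<Rightarrow> real"
  assumes "r \<in> borel_measurable borel" "\<And>x. 0 \<le> r x" "\<And>x. r x \<le> 1"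
  shows "(\<integral>x. r x * (c + d * x) \<partial>M) = c * (\<integral>x. r x \<partial>M) + d * (\<integral>x. r x * x \<partial>M)"
proof -
  have "integrable M r" "integrable M (\<lambda>x. r x * x)"
    using assms by (rule weight_integrable, rule weighted_integrable[OF _ _ _ integrable_id])
  then have "(\<integral>x. c * r x + d * (r x * x) \<partial>M) = c * (\<integral>x. r x \<partial>M) + d * (\<integral>x. r x * x \<partial>M)"
    by simp
  then show ?thesis by (simp add: algebra_simps)
qed

lemma weighted_eq_0:
  fixes r f :: "real \<Rightarrow> real"
  assumes "r \<in> borel_measurable borel" "\<And>x. 0 \<le> r x" "\<And>x. r x \<le> 1" "(\<integral>x. r x \<partial>M) = 0"
  shows "(\<integral>x. r x * f x \<partial>M) = 0"
proof -
  have "integrable M r"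
    using assms by (intro weight_integrable)
  then have "AE x in M. r x = 0"
    using assms by (subst (asm) integral_nonneg_eq_0_iff_AE) auto
  then show ?thesis by (intro integral_eq_zero_AE) auto
qed

lemma weighted_eq_total:
  fixes r f :: "real \<Rightarrow> real"
  assumes "r \<in> borel_measurable borel" "\<And>x. 0 \<le> r x" "\<And>x. r x \<le> 1"
    and "(\<integral>x. r x \<partial>M) = measure M UNIV" "integrable M f"
  shows "(\<integral>x. r x * f x \<partial>M) = integral\<^sup>L M f"
proof -
  have "integrable M r"
    using assms by (intro weight_integrable)
  then have "(\<integral>x. 1 - r x \<partial>M) = 0"
    using assms by simp
  then have "(\<integral>x. (1 - r x) * f x \<partial>M) = 0"
    using assms by (intro weighted_eq_0) auto
  moreover have "(\<integral>x. (1 - r x) * f x \<partial>M) = integral\<^sup>L M f - (\<integral>x. r x * f x \<partial>M)"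
    using assms weighted_integrable[of r f] by (simp add: left_diff_distrib)
  ultimately show ?thesis by simp
qed

text \<open>Pointwise: on \<open>E\<close> the factor \<open>r x \<le> 1\<close> can only increase
  the nonpositive value \<open>f x\<close>, and elsewhere \<open>r x * f x\<close> is nonnegative.
  When \<open>E\<close> has the mass and mean of \<open>r\<close>, affine terms of \<open>f\<close>
  cancel from the conclusion.\<close>

lemma bathtub:
  fixes r f :: "real \<Rightarrow> real"
  assumes "r \<in> borel_measurable borel" "\<And>x. 0 \<le> r x" "\<And>x. r x \<le> 1"
    and "E \<in> sets borel" "integrable M f"
    and "\<And>x. x \<in> E \<Longrightarrow> f x \<le> 0" "\<And>x. x \<notin> E \<Longrightarrow> 0 \<le> f x"
  shows "(LINT x:E|M. f x) \<le> (\<integral>x. r x * f x \<partial>M)"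
  unfolding set_lebesgue_integral_def
proof (rule integral_mono)
  show "integrable M (\<lambda>x. indicat_real E x *\<^sub>R f x)"
    using set_integrable[of f E] assms by (simp add: set_integrable_def)
  show "integrable M (\<lambda>x. r x * f x)"
    using assms by (intro weighted_integrable)
  fix x
  show "indicat_real E x *\<^sub>R f x \<le> r x * f x"
    using assms(2,3,6,7)[of x] mult_right_mono_neg[of "r x" 1 "f x"] by (auto simp: indicator_def)
qed

end

context atomless_mean_measure
begin

lemma lower_diff_cases:
  obtains "lower t - lower s = UNIV"
  | "lower t - lower s = {} \<or> (\<exists>b. lower t - lower s = {..b}) \<or>
      (\<exists>a b. lower t - lower s = {..b} - {..a}) \<or> (\<exists>a. lower t - lower s = - {..a})"
  by (cases rule: lower_cases[of s]; cases rule: lower_cases[of t])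
    (auto simp flip: Compl_eq_Diff_UNIV)

text \<open>Sliding the window \<open>lower (s + m) - lower s\<close> of mass \<open>m\<close> to the right moves its mean
  continuously from the least to the greatest value possible for a density bounded by 1.\<close>

lemma interval_selection:
  assumes r: "r \<in> borel_measurable borel" "\<And>x. 0 \<le> r x" "\<And>x. r x \<le> 1"
  obtains E where "E \<in> sets borel" "measure M E = (\<integral>x. r x \<partial>M)"
    "(LINT x:E|M. x) = (\<integral>x. r x * x \<partial>M)"
    "\<And>k. (LINT x:E|M. max 0 (x - k)) \<le> (\<integral>x. r x * max 0 (x - k) \<partial>M)"
proof -
  let ?T = "measure M UNIV"
  define m where "m = (\<integral>x. r x \<partial>M)"
  define \<mu> where "\<mu> = (\<integral>x. r x * x \<partial>M)"
  have int_r: "integrable M r"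
    by (rule weight_integrable[OF r])
  have m: "0 \<le> m" "m \<le> ?T"
  proof -
    show "0 \<le> m" unfolding m_def using r by (intro integral_nonneg_AE) auto
    have "m \<le> (\<integral>x. 1 \<partial>M)" unfolding m_def using r int_r by (intro integral_mono) auto
    then show "m \<le> ?T" by simp
  qed
  have total: "lower_moment ?T = (\<integral>x. x \<partial>M)"
  proof -
    have "lower ?T = UNIV"
      using cdf_bounded by (auto simp: lower_def)
    then show ?thesis by (simp add: lower_moment_def set_integral_UNIV)
  qed
  \<comment> \<open>The leftmost window has the least mean: \<open>bathtub\<close> with
    \<open>x - a\<close>, where \<open>a\<close> is the right end of the window. An empty or full
    window forces \<open>r\<close> to be 0 or 1 almost everywhere.\<close>
  have left: "lower_moment (0 + m) - lower_moment 0 \<le> \<mu>"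
  proof (cases rule: lower_cases[of m])
    case 1
    then have "m = 0" using measure_lower[OF m] by simp
    then show ?thesis using weighted_eq_0[OF r, of "\<lambda>x. x"] by (simp add: m_def \<mu>_def)
  next
    case 2
    then have "m = ?T" using measure_lower[OF m] by simp
    then have "\<mu> = (\<integral>x. x \<partial>M)"
      using weighted_eq_total[OF r _ integrable_id] by (simp add: m_def \<mu>_def)
    then show ?thesis using \<open>m = ?T\<close> total lower_moment_0 by simp
  next
    case (3 a)
    have "(LINT x:lower m|M. - a + 1 * x) \<le> (\<integral>x. r x * (- a + 1 * x) \<partial>M)"
      using 3 by (intro bathtub r integrable_affine lower_borel) auto
    then show ?thesis
      using m unfolding set_integral_affine[OF lower_borel] weighted_affine[OF r]
      by (simp add: measure_lower lower_moment_0 flip: m_def \<mu>_def lower_moment_def)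
  qed
  have right: "\<mu> \<le> lower_moment ((?T - m) + m) - lower_moment (?T - m)"
  proof (cases rule: lower_cases[of "?T - m"])
    case 1
    then have "m = ?T" using measure_lower[of "?T - m"] m by simp
    then have "\<mu> = (\<integral>x. x \<partial>M)"
      using weighted_eq_total[OF r _ integrable_id] by (simp add: m_def \<mu>_def)
    then show ?thesis using \<open>m = ?T\<close> total lower_moment_0 by simp
  next
    case 2
    then have "m = 0" using measure_lower[of "?T - m"] m by simp
    then show ?thesis using weighted_eq_0[OF r, of "\<lambda>x. x"] by (simp add: m_def \<mu>_def)
  next
    case (3 a)
    have T: "lower ?T = UNIV"
      using cdf_bounded by (auto simp: lower_def)
    have b: "lower ?T - lower (?T - m) \<in> sets borel" by auto
    have "(LINT x:lower ?T - lower (?T - m)|M. a + (-1) * x) \<le> (\<integral>x. r x * (a + (-1) * x) \<partial>M)"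
      using 3 by (intro bathtub r integrable_affine b) (auto simp: T)
    then show ?thesis
      using m lower_moment_diff[of "?T - m" ?T] measure_lower_diff[of "?T - m" ?T]
      unfolding set_integral_affine[OF b] weighted_affine[OF r]
      by (simp flip: m_def \<mu>_def)
  qed
  have "continuous_on {0..?T - m} (\<lambda>s. lower_moment (s + m) - lower_moment s)"
    using m by (intro continuous_intros continuous_on_compose2[OF lower_moment_continuous]) auto
  from IVT'[OF left right _ this] m obtain s where
    s: "0 \<le> s" "s \<le> ?T - m" "lower_moment (s + m) - lower_moment s = \<mu>" by auto
  define E where "E = lower (s + m) - lower s"
  have E: "E \<in> sets borel" "measure M E = m" "(LINT x:E|M. x) = \<mu>"
    using s m measure_lower_diff[of s "s + m"] lower_moment_diff[of s "s + m"]
    by (auto simp: E_def)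
  have "(LINT x:E|M. max 0 (x - k)) \<le> (\<integral>x. r x * max 0 (x - k) \<partial>M)" for k
  proof (cases rule: lower_diff_cases[of "s + m" s])
    \<comment> \<open>The case excluded from \<open>call_separation\<close>: full mass forces
      \<open>r = 1\<close> almost everywhere.\<close>
    case 1
    then have "E = UNIV" by (simp add: E_def)
    then show ?thesis
      using weighted_eq_total[OF r _ integrable_call] E(2) by (simp add: m_def set_integral_UNIV)
  next
    case 2
    from call_separation[OF this, of k] obtain c d where
      sep: "\<And>y. y \<in> E \<Longrightarrow> max 0 (y - k) \<le> c + d * y" "\<And>y. y \<notin> E \<Longrightarrow> c + d * y \<le> max 0 (y - k)"
      by (auto simp: E_def)
    have "(LINT x:E|M. max 0 (x - k) - (c + d * x)) \<le> (\<integral>x. r x * (max 0 (x - k) - (c + d * x)) \<partial>M)"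
      using sep
      by (intro bathtub r E Bochner_Integration.integrable_diff integrable_call integrable_affine)
        (simp_all add: not_le)
    also have "\<dots> = (\<integral>x. r x * max 0 (x - k) \<partial>M) - (\<integral>x. r x * (c + d * x) \<partial>M)"
      unfolding right_diff_distrib
      by (intro Bochner_Integration.integral_diff weighted_integrable r integrable_call integrable_affine)
    finally have "(LINT x:E|M. max 0 (x - k) - (c + d * x)) \<le>
      (\<integral>x. r x * max 0 (x - k) \<partial>M) - (\<integral>x. r x * (c + d * x) \<partial>M)" .
    moreover have "(LINT x:E|M. max 0 (x - k) - (c + d * x)) =
        (LINT x:E|M. max 0 (x - k)) - (LINT x:E|M. c + d * x)"
      by (intro set_integral_diff set_integrable integrable_call integrable_affine E)
    ultimately show ?thesis
      unfolding set_integral_affine[OF E(1)] weighted_affine[OF r]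
      by (simp add: E flip: m_def \<mu>_def)
  qed
  with E that show thesis by (auto simp: m_def \<mu>_def)
qed

end

section \<open>Splitting a dominated measure at a threshold\<close>

text \<open>Convex order between the restrictions of \<open>M\<close> to \<open>A\<close> and of
  \<open>N\<close> to \<open>B\<close>, expressed by tests that determine it for finite first
  moments. Carrying sets instead of restricted measures lets later steps cut the pieces
  further.\<close>

definition call_dominated :: "real measure \<Rightarrow> real set \<Rightarrow> real measure \<Rightarrow> real set \<Rightarrow> bool" where
  "call_dominated M A N B \<longleftrightarrow>
     measure M A = measure N B \<and> (LINT x:A|M. x) = (LINT y:B|N. y) \<and>
     (\<forall>k. (LINT x:A|M. max 0 (x - k)) \<le> (LINT y:B|N. max 0 (y - k)))"

lemma convex_le_affine:
  fixes p :: "real \<Rightarrow> real"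
  assumes p: "convex_on UNIV p" and "a \<le> k" "k \<le> b"
    and "p a \<le> u + v * a" "p b \<le> u + v * b"
  shows "p k \<le> u + v * k"
proof -
  have "k \<in> closed_segment a b"
    using assms by (auto simp: closed_segment_eq_real_ivl)
  then obtain l where l: "0 \<le> l" "l \<le> 1" and k: "k = (1 - l) * a + l * b"
    by (auto simp: closed_segment_def)
  have "p k \<le> (1 - l) * p a + l * p b"
    using convex_onD[OF p l, of a b] by (simp add: k)
  also have "\<dots> \<le> (1 - l) * (u + v * a) + l * (u + v * b)"
    using assms l by (intro add_mono mult_left_mono) auto
  also have "\<dots> = u + v * k"
    by (simp add: k algebra_simps)
  finally show ?thesis .
qed

section \<open>Put and call integrals as functions of the strike\<close>

context finite_mean_measure
begin

text \<open>Put-call parity. For equal mass and mean it makes inequalities between calls and between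
  puts equivalent, so each side of a threshold can be treated with the more convenient of the
  two.\<close>

lemma set_integral_put:
  assumes "A \<in> sets borel"
  shows "(LINT x:A|M. max 0 (k - x)) =
    (LINT x:A|M. max 0 (x - k)) + k * measure M A - (LINT x:A|M. x)"
proof -
  have "(LINT x:A|M. max 0 (k - x)) = (LINT x:A|M. max 0 (x - k) + (k + (-1) * x))"
    by (intro set_lebesgue_integral_cong) (use assms in auto)
  also have "\<dots> = (LINT x:A|M. max 0 (x - k)) + (LINT x:A|M. k + (-1) * x)"
    by (intro set_integral_add set_integrable integrable_call integrable_affine assms)
  finally show ?thesis
    unfolding set_integral_affine[OF assms] by simp
qed

lemma convex_put:
  assumes "A \<in> sets borel"
  shows "convex_on UNIV (\<lambda>k. LINT x:A|M. max 0 (k - x))"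
proof (rule convex_onI)
  fix l a b :: real assume l: "0 < l" "l < 1"
  have "max 0 ((1 - l) * a + l * b - x) \<le> (1 - l) * max 0 (a - x) + l * max 0 (b - x)" for x
  proof -
    have "(1 - l) * (a - x) \<le> (1 - l) * max 0 (a - x)" "l * (b - x) \<le> l * max 0 (b - x)"
      "0 \<le> (1 - l) * max 0 (a - x)" "0 \<le> l * max 0 (b - x)"
      using l by (auto intro: mult_left_mono)
    moreover have "(1 - l) * a + l * b - x = (1 - l) * (a - x) + l * (b - x)"
      by (simp add: algebra_simps)
    ultimately show ?thesis by simp
  qed
  then have "(LINT x:A|M. max 0 ((1 - l) *\<^sub>R a + l *\<^sub>R b - x)) \<le>
      (LINT x:A|M. (1 - l) * max 0 (a - x) + l * max 0 (b - x))"
    using assms integrable_put by (intro set_integral_mono set_integrable) auto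
  also have "\<dots> = (LINT x:A|M. (1 - l) * max 0 (a - x)) + (LINT x:A|M. l * max 0 (b - x))"
    using assms integrable_put by (intro set_integral_add set_integrable) auto
  finally show "(LINT x:A|M. max 0 ((1 - l) *\<^sub>R a + l *\<^sub>R b - x)) \<le>
      (1 - l) * (LINT x:A|M. max 0 (a - x)) + l * (LINT x:A|M. max 0 (b - x))"
    by simp
qed simp

lemma convex_call:
  assumes "A \<in> sets borel"
  shows "convex_on UNIV (\<lambda>k. LINT x:A|M. max 0 (x - k))"
proof -
  have "convex_on UNIV (\<lambda>k. (LINT x:A|M. max 0 (k - x)) + ((LINT x:A|M. x) + - measure M A * k))"
    by (intro convex_on_add convex_put assms) (auto intro!: convex_onI simp: algebra_simps)
  moreover have "(LINT x:A|M. max 0 (x - k)) =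
      (LINT x:A|M. max 0 (k - x)) + ((LINT x:A|M. x) + - measure M A * k)" for k
    by (simp add: set_integral_put[OF assms])
  ultimately show ?thesis by simp
qed

lemma set_integral_mono_set:
  fixes f :: "real \<Rightarrow> real"
  assumes "integrable M f" "A \<in> sets borel" "B \<in> sets borel" "A \<subseteq> B" "\<And>x. 0 \<le> f x"
  shows "(LINT x:A|M. f x) \<le> (LINT x:B|M. f x)"
  using assms set_integrable[OF assms(1)] unfolding set_lebesgue_integral_def set_integrable_def
  by (intro integral_mono) (auto simp: indicator_def)

lemma set_integral_Compl:
  fixes f :: "real \<Rightarrow> real"
  assumes "integrable M f" "A \<in> sets borel"
  shows "(LINT x:- A|M. f x) = integral\<^sup>L M f - (LINT x:A|M. f x)"
  using set_integral_Un[of "- A" A M f] set_integrable assms by (simp add: set_integral_UNIV)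

lemma measure_Compl:
  assumes "A \<in> sets borel"
  shows "measure M (- A) = measure M UNIV - measure M A"
  using finite_measure_compl[of A] assms by (simp add: Compl_eq_Diff_UNIV)

text \<open>Jensen's inequality in the form needed: the left side is the call integral of any
  measure with the same mass and mean that lives to the right of \<open>k\<close>.\<close>

lemma set_integral_ge_affine_call:
  assumes "A \<in> sets borel"
  shows "(LINT x:A|M. x) - k * measure M A \<le> (LINT x:A|M. max 0 (x - k))"
proof -
  have "(LINT x:A|M. - k + 1 * x) \<le> (LINT x:A|M. max 0 (x - k))"
    using assms by (intro set_integral_mono set_integrable integrable_affine integrable_call) auto
  then show ?thesis unfolding set_integral_affine[OF assms] by simp
qed

lemma set_integral_ge_affine_put:
  assumes "A \<in> sets borel"
  shows "k * measure M A - (LINT x:A|M. x) \<le> (LINT x:A|M. max 0 (k - x))"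
proof -
  have "(LINT x:A|M. k + (-1) * x) \<le> (LINT x:A|M. max 0 (k - x))"
    using assms by (intro set_integral_mono set_integrable integrable_affine integrable_put) auto
  then show ?thesis unfolding set_integral_affine[OF assms] by simp
qed

text \<open>Meant for a put or call \<open>f\<close>, with \<open>B\<close> the part of
  \<open>A\<close> that carries it; there \<open>f\<close> is affine, so the mass and mean of
  \<open>B\<close> determine the integral.\<close>

lemma set_integral_eq_affine:
  assumes "A \<in> sets borel" "B \<in> sets borel"
    and "\<And>x. indicat_real A x * f x = indicat_real B x * (c + d * x)"
  shows "(LINT x:A|M. f x) = c * measure M B + d * (LINT x:B|M. x)"
proof -
  have "(LINT x:A|M. f x) = (LINT x:B|M. c + d * x)"
    unfolding set_lebesgue_integral_def by (simp add: assms(3))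
  then show ?thesis unfolding set_integral_affine[OF assms(2)] .
qed

end

context atomless_mean_measure
begin

lemma atMost_subset_lower: "{..t} \<subseteq> lower (measure M {..t})"
  by (auto simp: lower_def cdf_def intro: finite_measure_mono)

text \<open>\<open>lower (measure M {..t})\<close> may be larger than \<open>{..t}\<close>, but only by a null set.\<close>

lemma
  assumes "0 \<le> s" "s \<le> measure M {..t}"
  shows measure_atMost_Int_lower: "measure M ({..t} \<inter> lower s) = s"
    and integral_atMost_Int_lower: "(LINT x:{..t} \<inter> lower s|M. x) = lower_moment s"
proof -
  let ?\<tau> = "measure M {..t}"
  have \<tau>: "0 \<le> ?\<tau>" "?\<tau> \<le> measure M UNIV" by (auto intro: finite_measure_mono)
  have "measure M (lower s - {..t}) \<le> measure M (lower ?\<tau> - {..t})"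
    using lower_mono[OF assms(2)] by (intro finite_measure_mono) auto
  also have "\<dots> = 0"
    using finite_measure_Diff[OF _ _ atMost_subset_lower[of t]] measure_lower[OF \<tau>] by simp
  finally have null: "measure M (lower s - {..t}) = 0"
    by (simp add: measure_le_0_iff)
  have split: "lower s = ({..t} \<inter> lower s) \<union> (lower s - {..t})" by auto
  have "measure M (lower s) = measure M ({..t} \<inter> lower s) + measure M (lower s - {..t})"
    by (subst split, subst finite_measure_Union) auto
  then show "measure M ({..t} \<inter> lower s) = s"
    using measure_lower[of s] assms \<tau> null by simp
  have "lower_moment s = (LINT x:({..t} \<inter> lower s) \<union> (lower s - {..t})|M. x)"
    unfolding lower_moment_def using split by simp
  also have "\<dots> = (LINT x:{..t} \<inter> lower s|M. x) + (LINT x:lower s - {..t}|M. x)"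
    by (intro set_integral_Un set_integrable integrable_id) auto
  finally show "(LINT x:{..t} \<inter> lower s|M. x) = lower_moment s"
    using set_integral_null[OF _ null] by simp
qed

lemma
  assumes "measure M {..t} \<le> w" "w \<le> measure M UNIV"
  shows measure_greaterThan_Int_lower: "measure M ({t<..} \<inter> lower w) = w - measure M {..t}"
    and integral_greaterThan_Int_lower:
      "(LINT x:{t<..} \<inter> lower w|M. x) = lower_moment w - lower_moment (measure M {..t})"
proof -
  let ?\<tau> = "measure M {..t}"
  have \<tau>: "0 \<le> ?\<tau>" by simp
  have sub: "{..t} \<subseteq> lower w"
    using atMost_subset_lower[of t] lower_mono[OF assms(1)] by auto
  then have split: "lower w = {..t} \<union> ({t<..} \<inter> lower w)" by auto
  have "measure M (lower w) = ?\<tau> + measure M ({t<..} \<inter> lower w)"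
    by (subst split, subst finite_measure_Union) auto
  then show "measure M ({t<..} \<inter> lower w) = w - ?\<tau>"
    using measure_lower[of w] assms order_trans[OF \<tau> assms(1)] by simp
  have "lower_moment w = (LINT x:{..t} \<union> ({t<..} \<inter> lower w)|M. x)"
    unfolding lower_moment_def using split by simp
  also have "\<dots> = (LINT x:{..t}|M. x) + (LINT x:{t<..} \<inter> lower w|M. x)"
    by (intro set_integral_Un set_integrable integrable_id) auto
  finally show "(LINT x:{t<..} \<inter> lower w|M. x) = lower_moment w - lower_moment ?\<tau>"
    using integral_atMost_Int_lower[OF \<tau> order_refl] atMost_subset_lower[of t]
    by (simp add: Int_absorb2)
qed

text \<open>The part of \<open>P\<close> to the left of \<open>t\<close> receives a set of the form \<open>{..\<alpha>} \<union> {t<..\<gamma>}\<close>. Below \<open>\<alpha>\<close> the put function of this set is that of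
  \<open>M\<close>; between \<open>\<alpha>\<close> and \<open>t\<close> it is affine, while the put function of \<open>P\<close> on \<open>{..t}\<close> is convex; at \<open>t\<close>
  Jensen's inequality applies. The complement is treated symmetrically with call functions.\<close>

lemma call_dominated_split:
  assumes "finite_mean_measure P" and dom: "call_dominated P UNIV M UNIV"
  shows "\<exists>S\<in>sets borel. call_dominated P {..t} M S \<and> call_dominated P {t<..} M (- S)"
proof -
  interpret P: finite_mean_measure P by fact
  let ?T = "measure M UNIV"
  define \<tau> where "\<tau> = measure M {..t}"
  define m where "m = measure P {..t}"
  define \<mu> where "\<mu> = (LINT x:{..t}|P. x)"
  have T: "measure P UNIV = ?T" and mean: "(\<integral>x. x \<partial>P) = (\<integral>x. x \<partial>M)"
    and call: "(\<integral>x. max 0 (x - k) \<partial>P) \<le> (\<integral>x. max 0 (x - k) \<partial>M)" for k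
    using dom by (auto simp: call_dominated_def set_integral_UNIV P.set_integral_UNIV)
  have put: "(\<integral>x. max 0 (k - x) \<partial>P) \<le> (\<integral>x. max 0 (k - x) \<partial>M)" for k
    using call[of k] set_integral_put[of UNIV k] P.set_integral_put[of UNIV k] T mean
    by (simp add: set_integral_UNIV P.set_integral_UNIV)
  have \<tau>: "0 \<le> \<tau>" "\<tau> \<le> ?T" by (auto simp: \<tau>_def intro: finite_measure_mono)
  have m: "0 \<le> m" "m \<le> ?T" by (auto simp: m_def simp flip: T intro: P.finite_measure_mono)
  have Compl_t: "- {..t} = {t<..}" by auto
  have m2: "measure P {t<..} = ?T - m"
    using P.measure_Compl[of "{..t}"] by (simp add: Compl_t T m_def)
  have \<mu>2: "(LINT x:{t<..}|P. x) = (\<integral>x. x \<partial>M) - \<mu>"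
    using P.set_integral_Compl[OF P.integrable_id, of "{..t}"] by (simp add: Compl_t mean \<mu>_def)
  have \<mu>_le: "\<mu> \<le> t * m"
  proof -
    have "\<mu> \<le> (LINT x:{..t}|P. t + 0 * x)"
      unfolding \<mu>_def
      by (intro set_integral_mono P.set_integrable P.integrable_id P.integrable_affine) auto
    then show ?thesis using P.set_integral_affine[of "{..t}" t 0] by (simp add: m_def)
  qed
  have \<mu>2_ge: "t * (?T - m) \<le> (\<integral>x. x \<partial>M) - \<mu>"
  proof -
    have "(LINT x:{t<..}|P. t + 0 * x) \<le> (LINT x:{t<..}|P. x)"
      by (intro set_integral_mono P.set_integrable P.integrable_id P.integrable_affine) auto
    then show ?thesis using P.set_integral_affine[of "{t<..}" t 0] by (simp add: m2 \<mu>2)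
  qed
  have lower_T: "lower ?T = UNIV"
    using cdf_bounded by (auto simp: lower_def)
  then have moment_T: "lower_moment ?T = (\<integral>x. x \<partial>M)"
    by (simp add: lower_moment_def set_integral_UNIV)
  have moment_\<tau>: "lower_moment \<tau> = (LINT x:{..t}|M. x)"
    using integral_atMost_Int_lower[of \<tau> t] atMost_subset_lower[of t] \<tau>
    by (simp add: \<tau>_def Int_absorb2)
  \<comment> \<open>Mass \<open>s\<close> is taken from the far left, the remaining
    \<open>m - s\<close> directly to the right of \<open>t\<close>, that is, between the mass
    coordinates \<tau> and \<open>\<tau> + m - s\<close>; \<open>h s\<close> is the resulting first
    moment. The bounds \<open>lo\<close> and \<open>hi\<close> express that both amounts are
    nonnegative and available.\<close>
  define h where "h s = lower_moment s + lower_moment (\<tau> + m - s) - lower_moment \<tau>" for s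
  define lo where "lo = max 0 (m - (?T - \<tau>))"
  define hi where "hi = min \<tau> m"
  have lohi: "0 \<le> lo" "lo \<le> hi" "hi \<le> \<tau>" "hi \<le> m" "\<tau> + m - lo \<le> ?T"
    using m \<tau> by (auto simp: lo_def hi_def)
  \<comment> \<open>At \<open>hi\<close> the chosen set is, up to null sets, \<open>lower m\<close>,
    the leftmost set of mass \<open>m\<close>. Its first moment is compared with \<mu> through the
    put inequality at its endpoint \<open>a\<close>.\<close>
  have h_hi: "h hi \<le> \<mu>"
  proof -
    have "h hi = lower_moment m"
      by (cases "\<tau> \<le> m") (auto simp: h_def hi_def)
    also have "\<dots> \<le> \<mu>"
    proof (cases rule: lower_cases[of m])
      case 1
      then have "m = 0" using measure_lower[OF m] by simp
      then have "\<mu> = 0" unfolding m_def \<mu>_def by (intro P.set_integral_null) auto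
      then show ?thesis using \<open>m = 0\<close> lower_moment_0 by simp
    next
      case 2
      then have "m = ?T" using measure_lower[OF m] by simp
      then have "(LINT x:{t<..}|P. x) = 0" using m2 by (intro P.set_integral_null) auto
      then show ?thesis using \<mu>2 \<open>m = ?T\<close> moment_T by simp
    next
      case (3 a)
      have "a * m - \<mu> \<le> (LINT x:{..t}|P. max 0 (a - x))"
        using P.set_integral_ge_affine_put[of "{..t}" a] by (simp add: m_def \<mu>_def)
      also have "\<dots> \<le> (LINT x:UNIV|P. max 0 (a - x))"
        by (intro P.set_integral_mono_set P.integrable_put) auto
      also have "\<dots> \<le> (LINT x:UNIV|M. max 0 (a - x))"
        using put by (simp add: set_integral_UNIV P.set_integral_UNIV)
      also have "\<dots> = a * measure M (lower m) + (-1) * (LINT x:lower m|M. x)"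
        using 3 by (intro set_integral_eq_affine) (auto simp: indicator_def)
      finally show ?thesis
        by (simp add: measure_lower[OF m] lower_moment_def)
    qed
    finally show ?thesis .
  qed
  \<comment> \<open>At \<open>lo\<close> either nothing is taken left of \<open>t\<close>, and all
    chosen points exceed \<open>t\<close>, or everything right of \<open>t\<close> is taken, and all
    omitted points are at most \<open>t\<close>. Comparison with \<open>t\<close> decides, for the
    set itself or for its complement.\<close>
  have h_lo: "\<mu> \<le> h lo"
  proof (cases "m \<le> ?T - \<tau>")
    case True
    then have w: "measure M {..t} \<le> \<tau> + m" "\<tau> + m \<le> measure M UNIV"
      using m by (auto simp: \<tau>_def)
    have b: "{t<..} \<inter> lower (\<tau> + m) \<in> sets borel" by auto
    have "\<mu> \<le> t * measure M ({t<..} \<inter> lower (\<tau> + m))"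
      using measure_greaterThan_Int_lower[OF w] \<mu>_le by (simp add: \<tau>_def)
    also have "\<dots> = (LINT x:{t<..} \<inter> lower (\<tau> + m)|M. t + 0 * x)"
      unfolding set_integral_affine[OF b] by simp
    also have "\<dots> \<le> (LINT x:{t<..} \<inter> lower (\<tau> + m)|M. x)"
      by (intro set_integral_mono set_integrable integrable_id integrable_affine b) auto
    also have "\<dots> = h lo"
      using integral_greaterThan_Int_lower[OF w] True lower_moment_0
      by (simp add: h_def lo_def \<tau>_def)
    finally show ?thesis .
  next
    case False
    then have lo: "lo = m - (?T - \<tau>)" by (simp add: lo_def)
    have lo': "lo \<le> measure M {..t}" using lohi by (simp add: \<tau>_def)
    have b: "{..t} - lower lo \<in> sets borel" by auto
    have split: "{..t} = ({..t} - lower lo) \<union> ({..t} \<inter> lower lo)" by auto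
    have "measure M {..t} = measure M ({..t} - lower lo) + measure M ({..t} \<inter> lower lo)"
      by (subst split, subst finite_measure_Union) auto
    then have meas: "measure M ({..t} - lower lo) = ?T - m"
      using measure_atMost_Int_lower[OF lohi(1) lo'] lo by (simp add: \<tau>_def)
    have "(LINT x:{..t}|M. x) = (LINT x:({..t} - lower lo) \<union> ({..t} \<inter> lower lo)|M. x)"
      using split by simp
    also have "\<dots> = (LINT x:{..t} - lower lo|M. x) + (LINT x:{..t} \<inter> lower lo|M. x)"
      by (intro set_integral_Un set_integrable integrable_id) auto
    finally have "lower_moment \<tau> - lower_moment lo = (LINT x:{..t} - lower lo|M. x)"
      using integral_atMost_Int_lower[OF lohi(1) lo'] moment_\<tau> by simp
    also have "\<dots> \<le> (LINT x:{..t} - lower lo|M. t + 0 * x)"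
      by (intro set_integral_mono set_integrable integrable_id integrable_affine b) auto
    also have "\<dots> = t * (?T - m)"
      unfolding set_integral_affine[OF b] meas by simp
    finally show ?thesis
      using \<mu>2_ge moment_T by (simp add: h_def lo)
  qed
  have "continuous_on {lo..hi} h"
    unfolding h_def using lohi \<tau> m
    by (intro continuous_intros continuous_on_compose2[OF lower_moment_continuous]) auto
  from IVT2'[OF h_hi h_lo lohi(2) this] obtain s where s: "lo \<le> s" "s \<le> hi" "h s = \<mu>" by auto
  define w where "w = \<tau> + m - s"
  have sw: "0 \<le> s" "s \<le> \<tau>" "\<tau> \<le> w" "w \<le> ?T"
    using s lohi by (auto simp: w_def)
  define S where "S = ({..t} \<inter> lower s) \<union> ({t<..} \<inter> lower w)"
  have S: "S \<in> sets borel" by (auto simp: S_def)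
  have sub: "{..t} \<subseteq> lower w"
    using atMost_subset_lower[of t] lower_mono[OF sw(3)] by (auto simp: \<tau>_def)
  have mS: "measure M S = m"
    unfolding S_def using sw measure_atMost_Int_lower[of s t] measure_greaterThan_Int_lower[of t w]
    by (subst finite_measure_Union) (auto simp: \<tau>_def w_def)
  have \<mu>S: "(LINT x:S|M. x) = \<mu>"
  proof -
    have "(LINT x:S|M. x) = (LINT x:{..t} \<inter> lower s|M. x) + (LINT x:{t<..} \<inter> lower w|M. x)"
      unfolding S_def by (intro set_integral_Un set_integrable integrable_id) auto
    then show ?thesis
      using sw s integral_atMost_Int_lower[of s t] integral_greaterThan_Int_lower[of t w]
      by (simp add: h_def \<tau>_def w_def)
  qed
  have mS2: "measure M (- S) = ?T - m"
    using measure_Compl[OF S] mS by simp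
  have \<mu>S2: "(LINT x:- S|M. x) = (\<integral>x. x \<partial>M) - \<mu>"
    using set_integral_Compl[OF integrable_id S] \<mu>S by simp

  define p where "p k = (LINT x:{..t}|P. max 0 (k - x))" for k
  define C where "C k = (LINT x:S|M. max 0 (k - x))" for k
  have convex_p: "convex_on UNIV p"
    unfolding p_def by (rule P.convex_put) simp
  have p_mono: "p k \<le> p k'" if "k \<le> k'" for k k'
    unfolding p_def using that
    by (intro set_integral_mono P.set_integrable P.integrable_put) auto
  have p_right: "p k \<le> C k" if "t \<le> k" for k
  proof -
    have "p k = k * m + (-1) * \<mu>"
      unfolding p_def m_def \<mu>_def using that
      by (intro P.set_integral_eq_affine) (auto simp: indicator_def)
    then show ?thesis
      using set_integral_ge_affine_put[OF S, of k] by (simp add: mS \<mu>S C_def)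
  qed
  have p_left: "p k \<le> C k" if "k \<le> t" "cdf M k \<le> s" for k
  proof -
    have "x \<in> S" if "x < k" for x
      using that \<open>k \<le> t\<close> \<open>cdf M k \<le> s\<close> cdf_nondecreasing[of x k] by (auto simp: S_def lower_def)
    then have "C k = (LINT x:UNIV|M. max 0 (k - x))"
      unfolding C_def set_lebesgue_integral_def
      by (intro Bochner_Integration.integral_cong)
        (auto simp: indicator_def max_def, metis order_le_less)
    moreover have "p k \<le> (LINT x:UNIV|P. max 0 (k - x))"
      unfolding p_def by (intro P.set_integral_mono_set P.integrable_put) auto
    ultimately show ?thesis
      using put[of k] by (simp add: set_integral_UNIV P.set_integral_UNIV)
  qed
  have p_le: "p k \<le> C k" for k
  proof (cases "t \<le> k \<or> cdf M k \<le> s")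
    case True
    then show ?thesis using p_left p_right by (cases "t \<le> k") auto
  next
    case False
    then have k: "k < t" "k \<notin> lower s" by (auto simp: lower_def)
    show ?thesis
    proof (cases rule: lower_cases[of s])
      \<comment> \<open>With \<open>lower s\<close> empty there is no left anchor for the chord.
        Then \<open>S\<close> lies to the right of \<open>t\<close>, so \<open>C t = 0\<close>, and
        monotonicity of \<open>p\<close> replaces convexity.\<close>
      case 1
      then have "C t = 0"
        unfolding C_def set_lebesgue_integral_def
        by (intro integral_eq_zero_AE) (auto simp: S_def indicator_def)
      moreover have "0 \<le> C k"
        unfolding C_def set_lebesgue_integral_def by (intro integral_nonneg_AE) auto
      ultimately show ?thesis
        using p_mono[of k t] p_right[of t] k by simp
    next
      case 2
      with k show ?thesis by simp
    next
      case (3 a)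
      then have "a < k" using k by auto
      have C: "C y = - (LINT x:lower s \<inter> {..t}|M. x) + measure M (lower s \<inter> {..t}) * y"
        if "a \<le> y" "y \<le> t" for y
      proof -
        have "C y = y * measure M (lower s \<inter> {..t}) + (-1) * (LINT x:lower s \<inter> {..t}|M. x)"
          unfolding C_def using that 3
          by (intro set_integral_eq_affine S) (auto simp: S_def indicator_def)
        then show ?thesis by simp
      qed
      have "cdf M a \<le> s" using 3 by (auto simp: lower_def)
      then have "p a \<le> C a" "p t \<le> C t"
        using p_left[of a] p_right[of t] \<open>a < k\<close> k by auto
      then show ?thesis
        using \<open>a < k\<close> k convex_le_affine[OF convex_p, of a k t
          "- (LINT x:lower s \<inter> {..t}|M. x)" "measure M (lower s \<inter> {..t})"]
        by (simp add: C)
    qed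
  qed

  define q where "q k = (LINT x:{t<..}|P. max 0 (x - k))" for k
  define D where "D k = (LINT x:- S|M. max 0 (x - k))" for k
  have convex_q: "convex_on UNIV q"
    unfolding q_def by (rule P.convex_call) simp
  have q_mono: "q k' \<le> q k" if "k \<le> k'" for k k'
    unfolding q_def using that
    by (intro set_integral_mono P.set_integrable P.integrable_call) auto
  have q_left: "q k \<le> D k" if "k \<le> t" for k
  proof -
    have "q k = - k * (?T - m) + 1 * ((\<integral>x. x \<partial>M) - \<mu>)"
      unfolding q_def \<mu>2[symmetric] m2[symmetric] using that
      by (intro P.set_integral_eq_affine) (auto simp: indicator_def)
    then show ?thesis
      using set_integral_ge_affine_call[of "- S" k] S by (simp add: mS2 \<mu>S2 D_def)
  qed
  have q_right: "q k \<le> D k" if "t \<le> k" "\<And>x. k < x \<Longrightarrow> x \<notin> lower w" for k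
  proof -
    have "x \<notin> S" if "k < x" for x
      using that \<open>t \<le> k\<close> \<open>\<And>x. k < x \<Longrightarrow> x \<notin> lower w\<close>[of x] by (auto simp: S_def)
    then have "D k = (LINT x:UNIV|M. max 0 (x - k))"
      unfolding D_def set_lebesgue_integral_def
      by (intro Bochner_Integration.integral_cong) (auto simp: indicator_def max_def)
    moreover have "q k \<le> (LINT x:UNIV|P. max 0 (x - k))"
      unfolding q_def by (intro P.set_integral_mono_set P.integrable_call) auto
    ultimately show ?thesis
      using call[of k] by (simp add: set_integral_UNIV P.set_integral_UNIV)
  qed
  have q_le: "q k \<le> D k" for k
  proof (cases "k \<le> t")
    case True
    then show ?thesis by (rule q_left)
  next
    case False
    show ?thesis
    proof (cases rule: lower_cases[of w])
      case 1
      then show ?thesis using q_right[of k] False by auto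
    next
      case 2
      then have "D t = 0"
        unfolding D_def set_lebesgue_integral_def
        by (intro integral_eq_zero_AE) (auto simp: S_def indicator_def)
      moreover have "0 \<le> D k"
        unfolding D_def set_lebesgue_integral_def by (intro integral_nonneg_AE) auto
      ultimately show ?thesis
        using q_mono[of t k] q_left[of t] False by simp
    next
      case (3 b)
      then have "t \<le> b" using sub by auto
      show ?thesis
      proof (cases "b \<le> k")
        case True
        then show ?thesis using q_right[of k] False 3 by auto
      next
        case kb: False
        have D: "D y = (LINT x:- lower w|M. x) + - measure M (- lower w) * y"
          if "t \<le> y" "y \<le> b" for y
        proof -
          have "D y = - y * measure M (- lower w) + 1 * (LINT x:- lower w|M. x)"
            unfolding D_def using that 3 S
            by (intro set_integral_eq_affine) (auto simp: S_def indicator_def)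
          then show ?thesis by simp
        qed
        have "q t \<le> D t" "q b \<le> D b"
          using q_left[of t] q_right[of b] \<open>t \<le> b\<close> 3 by auto
        then show ?thesis
          using kb False convex_le_affine[OF convex_q, of t k b
            "LINT x:- lower w|M. x" "- measure M (- lower w)"]
          by (simp add: D)
      qed
    qed
  qed
  have "call_dominated P {..t} M S"
    unfolding call_dominated_def
  proof (intro conjI allI)
    fix k show "(LINT x:{..t}|P. max 0 (x - k)) \<le> (LINT y:S|M. max 0 (y - k))"
      using p_le[of k] unfolding p_def C_def P.set_integral_put[of "{..t}", simplified] set_integral_put[OF S]
      by (simp add: mS \<mu>S flip: m_def \<mu>_def)
  qed (simp_all add: mS \<mu>S flip: m_def \<mu>_def)
  moreover have "call_dominated P {t<..} M (- S)"
    using q_le unfolding call_dominated_def by (simp add: q_def D_def m2 mS2 \<mu>2 \<mu>S2)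
  ultimately show ?thesis using S by blast
qed

end

section \<open>Replacing densities by indicators\<close>

text \<open>The bound is left unspecified so that weights are closed under addition; boundedness is
  what keeps first moments finite when passing to \<open>density M u\<close>.\<close>

definition weight :: "(real \<Rightarrow> real) \<Rightarrow> bool" where
  "weight u \<longleftrightarrow> u \<in> borel_measurable borel \<and> (\<forall>x. 0 \<le> u x) \<and> (\<exists>K. \<forall>x. u x \<le> K)"

lemma weightI: "u \<in> borel_measurable borel \<Longrightarrow> (\<And>x. 0 \<le> u x) \<Longrightarrow> (\<And>x. u x \<le> K) \<Longrightarrow> weight u"
  by (auto simp: weight_def)

lemma weight_measurable [measurable_dest]: "weight u \<Longrightarrow> u \<in> borel_measurable borel"
  and weight_nonneg: "weight u \<Longrightarrow> 0 \<le> u x"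
  by (auto simp: weight_def)

lemma weight_add:
  assumes "weight u" "weight v"
  shows "weight (\<lambda>x. u x + v x)"
proof -
  obtain K L where "\<And>x. u x \<le> K" "\<And>x. v x \<le> L" using assms by (auto simp: weight_def)
  then show ?thesis
    using assms by (intro weightI[of _ "K + L"] add_mono add_nonneg_nonneg)
      (auto simp: weight_nonneg weight_measurable)
qed

lemma weight_sum: "(\<And>i. i \<in> I \<Longrightarrow> weight (u i)) \<Longrightarrow> weight (\<lambda>x. \<Sum>i\<in>I. u i x)"
proof (induction I rule: infinite_finite_induct)
  case (insert i I)
  then show ?case by (simp add: weight_add)
qed (simp_all add: weightI[of _ 0])

lemma weight_indicator:
  assumes "weight u" "A \<in> sets borel"
  shows "weight (\<lambda>x. u x * indicat_real A x)"
proof -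
  obtain K where "\<And>x. u x \<le> K" "\<And>x. 0 \<le> u x" using assms by (auto simp: weight_def)
  then have "u x * indicat_real A x \<le> max 0 K" for x
    by (auto simp: indicator_def le_max_iff_disj)
  then show ?thesis
    using assms by (intro weightI[of _ "max 0 K"]) (auto simp: weight_nonneg weight_measurable)
qed

section \<open>Measures with a bounded density\<close>

context finite_mean_measure
begin

lemma weight_times_integrable:
  fixes f :: "real \<Rightarrow> real"
  assumes "weight u" "integrable M f"
  shows "integrable M (\<lambda>x. u x * f x)"
proof -
  obtain K where K: "\<And>x. u x \<le> K" "\<And>x. 0 \<le> u x" using assms by (auto simp: weight_def)
  have "integrable M (\<lambda>x. K * f x)" using assms by simp
  then show ?thesis
  proof (rule Bochner_Integration.integrable_bound)
    show "AE x in M. norm (u x * f x) \<le> norm (K * f x)"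
      using K by (auto simp: abs_mult intro!: mult_right_mono order_trans[OF K(1)])
  qed (use assms in \<open>auto simp: weight_measurable\<close>)
qed

lemma integrable_weight: "weight u \<Longrightarrow> integrable M u"
  using weight_times_integrable[of u "\<lambda>_. 1"] by simp

lemma integral_density_weight:
  fixes f :: "real \<Rightarrow> real"
  assumes "weight u" "f \<in> borel_measurable borel"
  shows "(\<integral>x. f x \<partial>density M (\<lambda>x. ennreal (u x))) = (\<integral>x. u x * f x \<partial>M)"
  using assms by (subst integral_real_density) (auto simp: weight_nonneg weight_measurable)

lemma integrable_density_weight:
  fixes f :: "real \<Rightarrow> real"
  assumes "weight u" "integrable M f"
  shows "integrable (density M (\<lambda>x. ennreal (u x))) f"
  using assms weight_times_integrable[OF assms]
  by (subst integrable_real_density) (auto simp: weight_nonneg weight_measurable)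

lemma finite_mean_density:
  assumes "weight u"
  shows "finite_mean_measure (density M (\<lambda>x. ennreal (u x)))"
proof -
  have "emeasure (density M (\<lambda>x. ennreal (u x))) UNIV = (\<integral>\<^sup>+x. ennreal (u x) \<partial>M)"
    using assms by (subst emeasure_density) (auto simp: weight_measurable)
  also have "\<dots> < \<infinity>"
    using integrable_weight[OF assms] assms
    by (auto simp: integrable_iff_bounded weight_nonneg)
  finally have "finite_measure (density M (\<lambda>x. ennreal (u x)))"
    by (intro finite_measureI) auto
  moreover have "integrable (density M (\<lambda>x. ennreal (u x))) (\<lambda>x. x)"
    using integrable_density_weight[OF assms integrable_id] .
  ultimately show ?thesis
    by (auto simp: finite_mean_measure_def finite_mean_measure_axioms_def
        finite_borel_measure_def finite_borel_measure_axioms_def)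
qed

lemma measure_density_weight:
  assumes "weight u" "A \<in> sets borel"
  shows "measure (density M (\<lambda>x. ennreal (u x))) A = (\<integral>x. u x * indicat_real A x \<partial>M)"
proof -
  interpret D: finite_mean_measure "density M (\<lambda>x. ennreal (u x))"
    using assms(1) by (rule finite_mean_density)
  show ?thesis
    using integral_density_weight[OF assms(1), of "indicator A"] assms by simp
qed

end

context atomless_mean_measure
begin

lemma atomless_mean_density:
  assumes "weight u"
  shows "atomless_mean_measure (density M (\<lambda>x. ennreal (u x)))"
proof -
  interpret D: finite_mean_measure "density M (\<lambda>x. ennreal (u x))"
    using assms by (rule finite_mean_density)
  have "measure (density M (\<lambda>x. ennreal (u x))) {a} = 0" for a
  proof -
    have "(\<integral>x. u x * indicat_real {a} x \<partial>M) = (LINT x:{a}|M. u x)"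
      by (simp add: set_lebesgue_integral_def mult.commute)
    also have "\<dots> = 0" by (intro set_integral_null no_atoms) auto
    finally show ?thesis using assms by (subst measure_density_weight) auto
  qed
  then show ?thesis
    using D.finite_mean_measure_axioms
    by (auto simp: atomless_mean_measure_def atomless_mean_measure_axioms_def)
qed

text \<open>This is \<open>interval_selection\<close> for the measure with density \<open>g\<close>
  and the ratio \<open>u / g\<close>. Where \<open>g\<close> vanishes so does \<open>u\<close>,
  hence the convention for division by zero does no harm.\<close>

lemma weighted_interval_selection:
  assumes u: "weight u" and g: "weight g" and le: "\<And>x. u x \<le> g x"
  obtains E where "E \<in> sets borel" "(\<integral>x. g x * indicat_real E x \<partial>M) = (\<integral>x. u x \<partial>M)"
    "(\<integral>x. g x * indicat_real E x * x \<partial>M) = (\<integral>x. u x * x \<partial>M)"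
    "\<And>k. (\<integral>x. g x * indicat_real E x * max 0 (x - k) \<partial>M) \<le> (\<integral>x. u x * max 0 (x - k) \<partial>M)"
proof -
  interpret D: atomless_mean_measure "density M (\<lambda>x. ennreal (g x))"
    using g by (rule atomless_mean_density)
  define r where "r x = u x / g x" for x
  have r: "r \<in> borel_measurable borel" "\<And>x. 0 \<le> r x" "\<And>x. r x \<le> 1"
  proof -
    show "r \<in> borel_measurable borel"
      unfolding r_def[abs_def] using u g by (auto simp: weight_measurable)
    show "0 \<le> r x" for x
      unfolding r_def using u g by (intro divide_nonneg_nonneg weight_nonneg)
    show "r x \<le> 1" for x
      unfolding r_def using le[of x] weight_nonneg[OF g, of x] by (intro divide_le_eq_1[THEN iffD2]) linarith
  qed
  have gr: "g x * r x = u x" for x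
    using weight_nonneg[OF u, of x] le[of x] by (cases "g x = 0") (auto simp: r_def)
  obtain E where E: "E \<in> sets borel" and
    *: "measure (density M (\<lambda>x. ennreal (g x))) E = (\<integral>x. r x \<partial>density M (\<lambda>x. ennreal (g x)))"
    "(LINT x:E|density M (\<lambda>x. ennreal (g x)). x) = (\<integral>x. r x * x \<partial>density M (\<lambda>x. ennreal (g x)))"
    "\<And>k. (LINT x:E|density M (\<lambda>x. ennreal (g x)). max 0 (x - k)) \<le>
       (\<integral>x. r x * max 0 (x - k) \<partial>density M (\<lambda>x. ennreal (g x)))"
    by (rule D.interval_selection[OF r]) blast
  note [measurable] = r(1) E
  have "(\<integral>x. g x * indicat_real E x \<partial>M) = (\<integral>x. u x \<partial>M)"
    using *(1) by (simp add: measure_density_weight g E integral_density_weight gr)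
  moreover have "(\<integral>x. g x * indicat_real E x * x \<partial>M) = (\<integral>x. u x * x \<partial>M)"
    using *(2) unfolding set_lebesgue_integral_def
    by (simp add: integral_density_weight[OF g] gr mult.assoc[symmetric])
  moreover have "(\<integral>x. g x * indicat_real E x * max 0 (x - k) \<partial>M) \<le> (\<integral>x. u x * max 0 (x - k) \<partial>M)" for k
    using *(3)[of k] unfolding set_lebesgue_integral_def
    by (simp add: integral_density_weight[OF g] gr mult.assoc[symmetric])
  ultimately show thesis using E that by blast
qed

end

section \<open>Densities compared cell by cell\<close>

locale gridded_measure = atomless_mean_measure +
  fixes cell :: "real \<Rightarrow> nat"
  assumes cell_measurable [measurable]: "cell \<in> borel \<rightarrow>\<^sub>M count_space UNIV"
begin

definition cell_integral :: "nat \<Rightarrow> (real \<Rightarrow> real) \<Rightarrow> (real \<Rightarrow> real) \<Rightarrow> real" where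
  "cell_integral l u f = (\<integral>x. u x * indicat_real {x. cell x = l} x * f x \<partial>M)"

definition moments :: "(real \<Rightarrow> real) set" where
  "moments = {\<lambda>_. 1, \<lambda>x. x}"

text \<open>Mass and mean are fixed in every cell, but calls are controlled in the single cell
  \<open>i\<close>. This limited demand leaves room to serve two densities at once, each in its own
  cell.\<close>

definition spreads :: "nat \<Rightarrow> (real \<Rightarrow> real) \<Rightarrow> (real \<Rightarrow> real) \<Rightarrow> bool" where
  "spreads i u v \<longleftrightarrow>
     (\<forall>l. \<forall>f\<in>moments. cell_integral l u f = cell_integral l v f) \<and>
     (\<forall>k. cell_integral i u (\<lambda>x. max 0 (x - k)) \<le> cell_integral i v (\<lambda>x. max 0 (x - k)))"

lemma cell_sets [measurable, simp]: "{x. cell x = l} \<in> sets borel"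
  using measurable_sets[OF cell_measurable, of "{l}"] by (simp add: vimage_def)

lemma integrable_moments: "f \<in> moments \<Longrightarrow> integrable M f"
  using integrable_id by (auto simp: moments_def)

lemma cell_integral_add:
  assumes "weight u" "weight v" "integrable M f"
  shows "cell_integral l (\<lambda>x. u x + v x) f = cell_integral l u f + cell_integral l v f"
proof -
  have "integrable M (\<lambda>x. (w x * indicat_real {x. cell x = l} x) * f x)" if "weight w" for w
    using that assms by (intro weight_times_integrable weight_indicator) auto
  from this[OF assms(1)] this[OF assms(2)] show ?thesis
    unfolding cell_integral_def by (simp add: distrib_right)
qed

lemma cell_integral_sum:
  assumes "\<And>i. i \<in> I \<Longrightarrow> weight (u i)" "integrable M f"
  shows "cell_integral l (\<lambda>x. \<Sum>i\<in>I. u i x) f = (\<Sum>i\<in>I. cell_integral l (u i) f)"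
  using assms
proof (induction I rule: infinite_finite_induct)
  case (insert i I)
  then show ?case
    using cell_integral_add[of "u i" "\<lambda>x. \<Sum>i\<in>I. u i x" f l] by (simp add: weight_sum)
qed (simp_all add: cell_integral_def)

lemma spreads_trans: "spreads i u v \<Longrightarrow> spreads i v w \<Longrightarrow> spreads i u w"
  unfolding spreads_def by (auto intro: order_trans)

lemma spreads_sum:
  assumes "\<And>j. j \<in> I \<Longrightarrow> weight (u j)" "\<And>j. j \<in> I \<Longrightarrow> weight (v j)"
    and "\<And>j. j \<in> I \<Longrightarrow> spreads i (u j) (v j)"
  shows "spreads i (\<lambda>x. \<Sum>j\<in>I. u j x) (\<lambda>x. \<Sum>j\<in>I. v j x)"
  unfolding spreads_def
proof (intro conjI allI ballI)
  fix l f assume f: "f \<in> moments"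
  have "(\<Sum>j\<in>I. cell_integral l (u j) f) = (\<Sum>j\<in>I. cell_integral l (v j) f)"
    using assms(3) f by (intro sum.cong refl) (simp add: spreads_def)
  then show "cell_integral l (\<lambda>x. \<Sum>j\<in>I. u j x) f = cell_integral l (\<lambda>x. \<Sum>j\<in>I. v j x) f"
    using assms(1,2) integrable_moments[OF f] by (simp add: cell_integral_sum)
next
  fix k :: real
  let ?f = "\<lambda>x. max 0 (x - k) :: real"
  have "(\<Sum>j\<in>I. cell_integral i (u j) ?f) \<le> (\<Sum>j\<in>I. cell_integral i (v j) ?f)"
    using assms(3) by (intro sum_mono) (simp add: spreads_def)
  then show "cell_integral i (\<lambda>x. \<Sum>j\<in>I. u j x) ?f \<le> cell_integral i (\<lambda>x. \<Sum>j\<in>I. v j x) ?f"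
    using assms(1,2) integrable_call[of k] by (simp add: cell_integral_sum)
qed

lemma spreads_refl: "spreads i u u"
  by (simp add: spreads_def)

text \<open>In the \<open>i\<close>-th cell the density \<open>v\<close> is contracted to an interval, in all other cells \<open>u\<close> is.\<close>

lemma pair_separation:
  assumes u: "weight u" and v: "weight v" and "i \<noteq> j"
  obtains E where "E \<in> sets borel"
    "spreads i u (\<lambda>x. (u x + v x) * indicat_real E x)"
    "spreads j v (\<lambda>x. (u x + v x) * indicat_real (- E) x)"
proof -
  let ?g = "\<lambda>x. u x + v x"
  let ?call = "\<lambda>k x. max 0 (x - k) :: real"
  have g: "weight ?g" using u v by (rule weight_add)
  have add: "cell_integral l ?g f = cell_integral l u f + cell_integral l v f"
    if "integrable M f" for f l
    using cell_integral_add[OF u v that] .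
  have compl: "cell_integral l (\<lambda>x. ?g x * indicat_real (- E) x) f =
      cell_integral l ?g f - cell_integral l (\<lambda>x. ?g x * indicat_real E x) f"
    if "integrable M f" "E \<in> sets borel" for f l E
  proof -
    have "cell_integral l (\<lambda>x. ?g x * indicat_real (- E) x + ?g x * indicat_real E x) f =
        cell_integral l (\<lambda>x. ?g x * indicat_real (- E) x) f +
        cell_integral l (\<lambda>x. ?g x * indicat_real E x) f"
      using that g by (intro cell_integral_add weight_indicator) auto
    moreover have "(\<lambda>x. ?g x * indicat_real (- E) x + ?g x * indicat_real E x) = ?g"
      by (auto simp: indicator_def)
    ultimately show ?thesis by simp
  qed
  have select: "\<exists>E\<in>sets borel.
      (\<forall>f\<in>moments. cell_integral l (\<lambda>x. ?g x * indicat_real E x) f = cell_integral l w f) \<and>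
      (\<forall>k. cell_integral l (\<lambda>x. ?g x * indicat_real E x) (?call k) \<le> cell_integral l w (?call k))"
    if w: "weight w" "\<And>x. w x \<le> ?g x" for w l
  proof -
    let ?I = "indicat_real {x. cell x = l}"
    have "weight (\<lambda>x. w x * ?I x)" "weight (\<lambda>x. ?g x * ?I x)"
      using w g by (auto intro: weight_indicator)
    moreover have "w x * ?I x \<le> ?g x * ?I x" for x
      using w(2) by (auto simp: indicator_def)
    ultimately obtain E where E: "E \<in> sets borel"
      "(\<integral>x. ?g x * ?I x * indicat_real E x \<partial>M) = (\<integral>x. w x * ?I x \<partial>M)"
      "(\<integral>x. ?g x * ?I x * indicat_real E x * x \<partial>M) = (\<integral>x. w x * ?I x * x \<partial>M)"
      "\<And>k. (\<integral>x. ?g x * ?I x * indicat_real E x * ?call k x \<partial>M) \<le> (\<integral>x. w x * ?I x * ?call k x \<partial>M)"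
      by (rule weighted_interval_selection) blast
    have comm: "?g x * ?I x * indicat_real E x = ?g x * indicat_real E x * ?I x" for x
      by (simp add: ac_simps)
    show ?thesis
      using E unfolding comm by (intro bexI[of _ E]) (auto simp: cell_integral_def moments_def)
  qed
  define Q where "Q l E \<longleftrightarrow> E \<in> sets borel \<and>
      (\<forall>f\<in>moments. cell_integral l (\<lambda>x. ?g x * indicat_real E x) f = cell_integral l u f) \<and>
      (l = i \<longrightarrow> (\<forall>k. cell_integral l u (?call k) \<le> cell_integral l (\<lambda>x. ?g x * indicat_real E x) (?call k))) \<and>
      (l \<noteq> i \<longrightarrow> (\<forall>k. cell_integral l (\<lambda>x. ?g x * indicat_real E x) (?call k) \<le> cell_integral l u (?call k)))"
    for l E
  have "\<exists>E\<in>sets borel.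
      (\<forall>f\<in>moments. cell_integral l (\<lambda>x. ?g x * indicat_real E x) f = cell_integral l u f) \<and>
      (l = i \<longrightarrow> (\<forall>k. cell_integral l u (?call k) \<le> cell_integral l (\<lambda>x. ?g x * indicat_real E x) (?call k))) \<and>
      (l \<noteq> i \<longrightarrow> (\<forall>k. cell_integral l (\<lambda>x. ?g x * indicat_real E x) (?call k) \<le> cell_integral l u (?call k)))" for l
  proof (cases "l = i")
    case True
    \<comment> \<open>Here \<open>E\<close> belongs to \<open>v\<close> and the answer is its
      complement: with the sum of both densities fixed, a smaller call integral for \<open>v\<close>
      is a larger one for \<open>u\<close>.\<close>
    obtain E where E: "E \<in> sets borel"
      "\<forall>f\<in>moments. cell_integral l (\<lambda>x. ?g x * indicat_real E x) f = cell_integral l v f"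
      "\<forall>k. cell_integral l (\<lambda>x. ?g x * indicat_real E x) (?call k) \<le> cell_integral l v (?call k)"
      using select[OF v, of l] weight_nonneg[OF u] by auto
    then show ?thesis
      using True add integrable_moments integrable_call by (intro bexI[of _ "- E"]) (auto simp: compl)
  next
    case False
    then show ?thesis using select[OF u, of l] weight_nonneg[OF v] by auto
  qed
  then have "\<forall>l. \<exists>E. Q l E" unfolding Q_def by (intro allI) (rule bexE, assumption, blast)
  from choice[OF this] obtain F where Q: "\<forall>l. Q l (F l)" ..
  have F: "\<And>l. F l \<in> sets borel"
    "\<And>l f. f \<in> moments \<Longrightarrow> cell_integral l (\<lambda>x. ?g x * indicat_real (F l) x) f = cell_integral l u f"
    "\<And>k. cell_integral i u (?call k) \<le> cell_integral i (\<lambda>x. ?g x * indicat_real (F i) x) (?call k)"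
    "\<And>l k. l \<noteq> i \<Longrightarrow> cell_integral l (\<lambda>x. ?g x * indicat_real (F l) x) (?call k) \<le> cell_integral l u (?call k)"
    using Q by (simp_all add: Q_def)
  \<comment> \<open>All conditions concern one cell at a time, so the choices made in different
    cells can be glued freely.\<close>
  define E where "E = (\<Union>l. F l \<inter> {x. cell x = l})"
  have E: "E \<in> sets borel"
    unfolding E_def using F(1) by (intro sets.countable_UN) auto
  have local: "cell_integral l (\<lambda>x. ?g x * indicat_real E x) f =
      cell_integral l (\<lambda>x. ?g x * indicat_real (F l) x) f" for l f
    unfolding cell_integral_def
    by (intro Bochner_Integration.integral_cong) (auto simp: E_def indicator_def)
  have "spreads i u (\<lambda>x. ?g x * indicat_real E x)"
    using F(2,3) by (auto simp: spreads_def local)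
  moreover have "spreads j v (\<lambda>x. ?g x * indicat_real (- E) x)"
    using F(2) F(4)[of j] \<open>i \<noteq> j\<close> E integrable_moments integrable_call
    by (auto simp: spreads_def local compl add)
  ultimately show thesis using E that by blast
qed

text \<open>Induction on the number of densities. The new density is cut along the classes already
  found; on class i its part \<open>?v i\<close> has to be separated only from the block
  \<open>?u i\<close>, which there is the sum of all old densities. Class i keeps
  \<open>E i\<close>, and what is left over from all classes becomes class \<open>m\<close>.\<close>

lemma partition_separation:
  assumes "0 < m" "\<And>i. i < m \<Longrightarrow> weight (h i)"
  shows "\<exists>b \<in> borel \<rightarrow>\<^sub>M count_space UNIV. (\<forall>x. b x < m) \<and>
    (\<forall>i<m. spreads i (h i) (\<lambda>x. (\<Sum>j<m. h j x) * indicat_real {x. b x = i} x))"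
  using assms
proof (induction m rule: nat_induct_non_zero)
  case 1
  then show ?case by (intro bexI[of _ "\<lambda>_. 0"]) (auto simp: spreads_refl)
next
  case (Suc m)
  let ?w = "\<lambda>x. \<Sum>j<m. h j x"
  from Suc obtain b where b: "b \<in> borel \<rightarrow>\<^sub>M count_space UNIV" "\<And>x. b x < m"
    "\<And>i. i < m \<Longrightarrow> spreads i (h i) (\<lambda>x. ?w x * indicat_real {x. b x = i} x)"
    by (metis less_SucI)
  have b_sets: "{x. b x = i} \<in> sets borel" for i
    using measurable_sets[OF b(1), of "{i}"] by (simp add: vimage_def)
  have w: "weight ?w" and hm: "weight (h m)" using Suc.prems by (auto intro: weight_sum)
  let ?u = "\<lambda>i x. ?w x * indicat_real {x. b x = i} x"
  let ?v = "\<lambda>i x. h m x * indicat_real {x. b x = i} x"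
  have uv: "weight (?u i)" "weight (?v i)" for i
    using w hm b_sets by (auto intro: weight_indicator)
  define Q where "Q i E \<longleftrightarrow> E \<in> sets borel \<and>
      spreads i (?u i) (\<lambda>x. (?u i x + ?v i x) * indicat_real E x) \<and>
      spreads m (?v i) (\<lambda>x. (?u i x + ?v i x) * indicat_real (- E) x)" for i E
  have "\<exists>E. Q i E" if "i < m" for i
  proof -
    have "i \<noteq> m" using that by simp
    show ?thesis
      unfolding Q_def
      by (rule pair_separation[OF uv(1)[of i] uv(2)[of i] \<open>i \<noteq> m\<close>]) blast
  qed
  then have "\<forall>i. \<exists>E. i < m \<longrightarrow> Q i E" by blast
  from choice[OF this] obtain E where Q: "\<forall>i. i < m \<longrightarrow> Q i (E i)" ..
  have E: "\<And>i. i < m \<Longrightarrow> E i \<in> sets borel"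
    "\<And>i. i < m \<Longrightarrow> spreads i (?u i) (\<lambda>x. (?u i x + ?v i x) * indicat_real (E i) x)"
    "\<And>i. i < m \<Longrightarrow> spreads m (?v i) (\<lambda>x. (?u i x + ?v i x) * indicat_real (- E i) x)"
    using Q by (simp_all only: Q_def)
  define b' where "b' x = (if x \<in> E (b x) then b x else m)" for x
  have b'_eq: "{x. b' x = i} = (if i < m then E i \<inter> {x. b x = i}
      else if i = m then (\<Union>j<m. {x. b x = j} - E j) else {})" for i
    using b(2) by (auto simp: b'_def)
  have b': "b' \<in> borel \<rightarrow>\<^sub>M count_space UNIV"
  proof (subst measurable_count_space_eq_countable)
    have "{x. b' x = i} \<in> sets borel" for i
    proof -
      have "E j \<inter> {x. b x = j} \<in> sets borel" "{x. b x = j} - E j \<in> sets borel" if "j < m" for j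
        using E(1)[OF that] b_sets[of j] by auto
      then show ?thesis
        unfolding b'_eq by (auto intro!: sets.finite_UN)
    qed
    then show "b' \<in> space borel \<rightarrow> UNIV \<and> (\<forall>i\<in>UNIV. b' -` {i} \<inter> space borel \<in> sets borel)"
      by (simp add: vimage_def)
  qed auto
  have sum: "(\<Sum>j<Suc m. h j x) = ?w x + h m x" for x by simp
  have "spreads i (h i) (\<lambda>x. (\<Sum>j<Suc m. h j x) * indicat_real {x. b' x = i} x)" if "i < m" for i
  proof -
    have "(\<lambda>x. (?u i x + ?v i x) * indicat_real (E i) x) =
        (\<lambda>x. (\<Sum>j<Suc m. h j x) * indicat_real {x. b' x = i} x)"
      using that unfolding sum b'_eq by (auto simp: indicator_def)
    then show ?thesis using spreads_trans[OF b(3)[OF that] E(2)[OF that]] by simp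
  qed
  moreover have "spreads m (h m) (\<lambda>x. (\<Sum>j<Suc m. h j x) * indicat_real {x. b' x = m} x)"
  proof -
    \<comment> \<open>The density \<open>h m\<close> is the sum of its parts \<open>?v i\<close>,
      all spread in the same cell \<open>m\<close>, so the comparisons add up.\<close>
    have "spreads m (\<lambda>x. \<Sum>i<m. ?v i x) (\<lambda>x. \<Sum>i<m. (?u i x + ?v i x) * indicat_real (- E i) x)"
      using E(1,3) w hm b_sets by (intro spreads_sum weight_indicator weight_add) auto
    moreover have "(\<Sum>i<m. ?v i x) = h m x" for x
    proof -
      have "(\<Sum>i<m. ?v i x) = (\<Sum>i<m. if i = b x then h m x else 0)"
        by (intro sum.cong) (auto simp: indicator_def)
      then show ?thesis using b(2)[of x] by simp
    qed
    moreover have "(\<Sum>i<m. (?u i x + ?v i x) * indicat_real (- E i) x) =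
        (\<Sum>j<Suc m. h j x) * indicat_real {x. b' x = m} x" for x
    proof -
      have "(\<Sum>i<m. (?u i x + ?v i x) * indicat_real (- E i) x) =
          (\<Sum>i<m. if i = b x then (?w x + h m x) * indicat_real (- E i) x else 0)"
        by (intro sum.cong) (auto simp: indicator_def)
      also have "\<dots> = (?w x + h m x) * indicat_real (- E (b x)) x"
        using b(2)[of x] by (simp add: sum.delta)
      also have "\<dots> = (\<Sum>j<Suc m. h j x) * indicat_real {x. b' x = m} x"
        using b(2)[of x] by (auto simp: b'_def indicator_def)
      finally show ?thesis .
    qed
    ultimately show ?thesis by simp
  qed
  ultimately show ?case
    using b' b(2) by (intro bexI[of _ b']) (auto simp: b'_def less_Suc_eq)
qed

end

section \<open>Backward transport maps\<close>

context finite_mean_measure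
begin

lemma set_integral_restrict:
  fixes f :: "real \<Rightarrow> real"
  assumes "A \<in> sets borel" "C \<in> sets borel" "f \<in> borel_measurable borel"
  shows "(LINT x:C|density M (\<lambda>x. ennreal (indicat_real A x)). f x) = (LINT x:A \<inter> C|M. f x)"
proof -
  have "weight (indicat_real A)"
    using assms by (intro weightI[of _ 1]) (auto simp: indicator_def)
  then show ?thesis
    using assms unfolding set_lebesgue_integral_def
    by (simp add: integral_density_weight indicator_inter_arith mult.assoc)
qed

lemma measure_restrict:
  assumes "A \<in> sets borel" "C \<in> sets borel"
  shows "measure (density M (\<lambda>x. ennreal (indicat_real A x))) C = measure M (A \<inter> C)"
proof -
  have "weight (indicat_real A)"
    using assms by (intro weightI[of _ 1]) (auto simp: indicator_def)
  then show ?thesis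
    using assms by (simp add: measure_density_weight flip: indicator_inter_arith)
qed

text \<open>Dynkin's argument: both sides are countably additive in \<open>C\<close>,
  \<open>total\<close> handles complements, and open half-lines generate. With the constant 1 for
  \<open>g\<close> and \<open>h\<close> it transfers mass, with the identity the mean.\<close>

lemma set_integral_vimage_eqI:
  fixes f g h :: "real \<Rightarrow> real"
  assumes "finite_mean_measure P" and f [measurable]: "f \<in> borel_measurable borel"
    and g: "integrable M g" and h: "integrable P h"
    and half: "\<And>x. (LINT y:f -` {..<x}|M. g y) = (LINT y:{..<x}|P. h y)"
    and total: "integral\<^sup>L M g = integral\<^sup>L P h"
    and C: "C \<in> sets borel"
  shows "(LINT y:f -` C|M. g y) = (LINT y:C|P. h y)"
proof -
  interpret P: finite_mean_measure P by fact
  have vimage: "f -` C \<in> sets borel" if "C \<in> sets borel" for C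
    using measurable_sets[OF f that] by simp
  have "{..<a} \<inter> {..<b} = {..<min a b}" for a b :: real
    by auto
  then have "Int_stable (range lessThan :: real set set)"
    by (auto simp: Int_stable_def)
  moreover have "range lessThan \<subseteq> Pow (UNIV :: real set)" by simp
  moreover have "C \<in> sigma_sets UNIV (range lessThan)"
    using C unfolding borel_Iio by simp
  ultimately show ?thesis
  proof (induction rule: sigma_sets_induct_disjoint)
    case (basic A)
    then show ?case using half by auto
  next
    case (compl A)
    then have A: "A \<in> sets borel" by (simp add: borel_Iio)
    have "(LINT y:f -` (UNIV - A)|M. g y) = integral\<^sup>L M g - (LINT y:f -` A|M. g y)"
      using set_integral_Compl[OF g vimage[OF A]] by (simp add: vimage_Compl flip: Compl_eq_Diff_UNIV)
    also have "\<dots> = (LINT y:UNIV - A|P. h y)"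
      using P.set_integral_Compl[OF h A] compl total by (simp flip: Compl_eq_Diff_UNIV)
    finally show ?case .
  next
    case (union A)
    then have A: "A i \<in> sets borel" for i by (auto simp: borel_Iio)
    have "(LINT y:f -` (\<Union>i. A i)|M. g y) = (\<Sum>i. LINT y:f -` A i|M. g y)"
      unfolding vimage_UN using A union(1) g
      by (intro lebesgue_integral_countable_add set_integrable)
        (auto intro!: vimage sets.countable_UN simp: disjoint_family_on_def)
    also have "\<dots> = (\<Sum>i. LINT y:A i|P. h y)" using union by simp
    also have "\<dots> = (LINT y:(\<Union>i. A i)|P. h y)"
      using A union(1) h
      by (intro lebesgue_integral_countable_add[symmetric] P.set_integrable)
        (auto simp: disjoint_family_on_def)
    finally show ?case .
  qed (simp add: set_lebesgue_integral_def)
qed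

end

lemma (in atomless_mean_measure) call_dominated_split_set:
  assumes "finite_mean_measure P" "A \<in> sets borel" "B \<in> sets borel"
    and dom: "call_dominated P A M B"
  shows "\<exists>S\<in>sets borel. S \<subseteq> B \<and> call_dominated P (A \<inter> {..t}) M S \<and> call_dominated P (A \<inter> {t<..}) M (B - S)"
proof -
  interpret P: finite_mean_measure P by fact
  let ?P = "density P (\<lambda>x. ennreal (indicat_real A x))"
  let ?M = "density M (\<lambda>x. ennreal (indicat_real B x))"
  have w: "weight (indicat_real A)" "weight (indicat_real B)"
    using assms by (auto intro!: weightI[of _ 1] simp: indicator_def)
  interpret M': atomless_mean_measure ?M by (rule atomless_mean_density[OF w(2)])
  have dom_iff: "call_dominated ?P C ?M D \<longleftrightarrow> call_dominated P (A \<inter> C) M (B \<inter> D)"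
    if "C \<in> sets borel" "D \<in> sets borel" for C D
    using that assms(2,3)
    by (simp add: call_dominated_def P.measure_restrict measure_restrict
        P.set_integral_restrict set_integral_restrict)
  obtain S where "S \<in> sets borel" "call_dominated ?P {..t} ?M S" "call_dominated ?P {t<..} ?M (- S)"
    using M'.call_dominated_split[OF P.finite_mean_density[OF w(1)], of t] dom by (auto simp: dom_iff)
  moreover have "B - B \<inter> S = B \<inter> - S" by auto
  ultimately show ?thesis
    using assms(3) by (intro bexI[of _ "B \<inter> S"]) (simp_all add: dom_iff)
qed

section \<open>The backward map from nested threshold splits\<close>

locale dominated_pair = atomless_mean_measure + P: finite_mean_measure P for P +
  fixes q :: "nat \<Rightarrow> real"
  assumes range_q: "range q = \<rat>"
    and dominated: "call_dominated P UNIV M UNIV"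
begin

text \<open>The thresholds come in arbitrary order, so a cell of the first \<open>n\<close> of them
  is named by a set of indices rather than by a position; a name that belongs to no point denotes
  the empty cell.\<close>

definition code :: "nat \<Rightarrow> real \<Rightarrow> nat set" where
  "code n x = {i. i < n \<and> x \<le> q i}"

text \<open>A choice operator, because the recursion for \<open>state\<close> needs a split for
  every argument; that the chosen set has the required properties is part of the induction in
  \<open>state_dominated\<close>.\<close>

definition split_set :: "nat \<Rightarrow> nat set \<Rightarrow> real set \<Rightarrow> real set" where
  "split_set n J B = (SOME S. S \<in> sets borel \<and> S \<subseteq> B \<and>
     call_dominated P ({x. code n x = J} \<inter> {..q n}) M S \<and>
     call_dominated P ({x. code n x = J} \<inter> {q n<..}) M (B - S))"

text \<open>\<open>n \<in> state (Suc n) y\<close> decides whether the map to be constructed sends \<open>y\<close> below \<open>q n\<close>, so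
  \<open>state n y\<close> is meant to be the code of the image of \<open>y\<close>.\<close>

primrec state :: "nat \<Rightarrow> real \<Rightarrow> nat set" where
  "state 0 y = {}"
| "state (Suc n) y =
     (if y \<in> split_set n (state n y) {z. state n z = state n y} then insert n (state n y) else state n y)"

definition below :: "nat \<Rightarrow> real set" where
  "below n = {y. n \<in> state (Suc n) y}"

lemma state_subset: "state n y \<subseteq> {..<n}"
  by (induction n) auto

lemma code_Suc: "{x. code (Suc n) x = J} =
    (if n \<in> J then {x. code n x = J - {n}} \<inter> {..q n} else {x. code n x = J} \<inter> {q n<..})"
proof -
  have "code (Suc n) x = (if x \<le> q n then insert n (code n x) else code n x)" "n \<notin> code n x" for x
    by (auto simp: code_def less_Suc_eq)
  then show ?thesis by auto
qed

lemma code_sets: "{x. code n x = J} \<in> sets borel"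
proof (induction n arbitrary: J)
  case 0
  then show ?case by (cases "J = {}") (auto simp: code_def)
next
  case (Suc n)
  then show ?case unfolding code_Suc by auto
qed

text \<open>The invariant that keeps the recursion alive: domination on a cell yields the next
  split, and the split returns domination on both halves.\<close>

lemma state_dominated:
  "{y. state n y = J} \<in> sets borel \<and> call_dominated P {x. code n x = J} M {y. state n y = J}"
proof (induction n arbitrary: J)
  case 0
  show ?case
  proof (cases "J = {}")
    case True
    then show ?thesis using dominated by (simp add: code_def)
  next
    case False
    then have "{x. code 0 x = J} = {}" "{y. state 0 y = J} = {}" by (auto simp: code_def)
    then show ?thesis by (simp add: call_dominated_def set_lebesgue_integral_def)
  qed
next
  case (Suc n)
  let ?B = "\<lambda>J. {y. state n y = J}"
  let ?S = "\<lambda>J. split_set n J (?B J)"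
  have split: "?S J \<in> sets borel \<and> ?S J \<subseteq> ?B J \<and>
     call_dominated P ({x. code n x = J} \<inter> {..q n}) M (?S J) \<and>
     call_dominated P ({x. code n x = J} \<inter> {q n<..}) M (?B J - ?S J)" for J
  proof -
    have "\<exists>S. S \<in> sets borel \<and> S \<subseteq> ?B J \<and>
        call_dominated P ({x. code n x = J} \<inter> {..q n}) M S \<and>
        call_dominated P ({x. code n x = J} \<inter> {q n<..}) M (?B J - S)"
      using call_dominated_split_set[OF P.finite_mean_measure_axioms code_sets
          conjunct1[OF Suc[of J]] conjunct2[OF Suc[of J]], of "q n"]
      unfolding Bex_def .
    from someI_ex[OF this] show ?thesis unfolding split_set_def .
  qed
  have "{y. state (Suc n) y = J} = (if n \<in> J then ?S (J - {n}) else ?B J - ?S J)"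
  proof (cases "n \<in> J")
    case True
    have n: "n \<notin> state n y" for y using state_subset[of n y] by auto
    have "state (Suc n) y = J \<longleftrightarrow> y \<in> ?S (J - {n})" for y
    proof
      assume y: "state (Suc n) y = J"
      then have "y \<in> ?S (state n y)" "insert n (state n y) = J"
        using True n[of y] by (auto split: if_splits)
      moreover from this n[of y] have "state n y = J - {n}" by auto
      ultimately show "y \<in> ?S (J - {n})" by simp
    next
      assume y: "y \<in> ?S (J - {n})"
      then have "state n y = J - {n}" using split[of "J - {n}"] by auto
      then show "state (Suc n) y = J" using y True by auto
    qed
    then show ?thesis using True by auto
  next
    case False
    then show ?thesis by auto
  qed
  then show ?case
    unfolding code_Suc using split[of "J - {n}"] split[of J] Suc[of J] by auto
qed

text \<open>A decision about a threshold is never revised later.\<close>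

lemma state_mono: "n < N \<Longrightarrow> n \<in> state N y \<longleftrightarrow> y \<in> below n"
proof (induction N)
  case (Suc N)
  then show ?case by (cases "n = N") (auto simp: below_def)
qed simp

text \<open>A condition on codes is a finite disjoint union of cells, so the equalities of mass and
  mean add up. This gives access to conditions on several thresholds at once.\<close>

lemma
  shows state_sets: "{y. R (state n y)} \<in> sets borel"
    and measure_state: "measure M {y. R (state n y)} = measure P {x. R (code n x)}"
    and integral_state: "(LINT y:{y. R (state n y)}|M. y) = (LINT x:{x. R (code n x)}|P. x)"
proof -
  define I where "I = {J \<in> Pow {..<n}. R J}"
  have I: "finite I" by (simp add: I_def)
  have state_UN: "{y. R (state n y)} = (\<Union>J\<in>I. {y. state n y = J})"
    using state_subset[of n] by (auto simp: I_def)
  have code_UN: "{x. R (code n x)} = (\<Union>J\<in>I. {x. code n x = J})"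
    by (auto simp: I_def code_def)
  have disj: "disjoint_family_on (\<lambda>J. {y. state n y = J}) I"
    "disjoint_family_on (\<lambda>J. {x. code n x = J}) I"
    by (auto simp: disjoint_family_on_def)
  show "{y. R (state n y)} \<in> sets borel"
    unfolding state_UN using I state_dominated by auto
  have "measure M {y. R (state n y)} = (\<Sum>J\<in>I. measure M {y. state n y = J})"
    unfolding state_UN using I disj(1) state_dominated
    by (intro finite_measure_finite_Union) auto
  also have "\<dots> = (\<Sum>J\<in>I. measure P {x. code n x = J})"
    using state_dominated by (intro sum.cong) (auto simp: call_dominated_def)
  also have "\<dots> = measure P {x. R (code n x)}"
    unfolding code_UN using I disj(2) code_sets
    by (intro P.finite_measure_finite_Union[symmetric]) auto
  finally show "measure M {y. R (state n y)} = measure P {x. R (code n x)}" .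
  have "(LINT y:{y. R (state n y)}|M. y) = (\<Sum>J\<in>I. LINT y:{y. state n y = J}|M. y)"
    unfolding state_UN using I disj(1) state_dominated integrable_id
    by (intro set_integral_finite_Union set_integrable) auto
  also have "\<dots> = (\<Sum>J\<in>I. LINT x:{x. code n x = J}|P. x)"
    using state_dominated by (intro sum.cong) (auto simp: call_dominated_def)
  also have "\<dots> = (LINT x:{x. R (code n x)}|P. x)"
    unfolding code_UN using I disj(2) code_sets P.integrable_id
    by (intro set_integral_finite_Union[symmetric] P.set_integrable) auto
  finally show "(LINT y:{y. R (state n y)}|M. y) = (LINT x:{x. R (code n x)}|P. x)" .
qed

declare state.simps(2) [simp del]

lemma code_iff: "n < N \<Longrightarrow> n \<in> code N x \<longleftrightarrow> x \<le> q n"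
  by (auto simp: code_def)

lemma below_sets [measurable, simp]: "below n \<in> sets borel"
  using state_sets[of "\<lambda>J. n \<in> J" "Suc n"] by (simp add: below_def)

lemma measure_below: "measure M (below n) = measure P {..q n}"
  using measure_state[of "\<lambda>J. n \<in> J" "Suc n"] by (simp add: state_mono code_iff atMost_def)

lemma integral_below: "(LINT y:below n|M. y) = (LINT x:{..q n}|P. x)"
  using integral_state[of "\<lambda>J. n \<in> J" "Suc n"] by (simp add: state_mono code_iff atMost_def)

text \<open>The sets \<open>below n\<close> are not nested by construction, only up to null sets:
  the offending set has the mass of a condition on codes that no point satisfies.\<close>

lemma measure_below_diff: "q i \<le> q j \<Longrightarrow> measure M (below i - below j) = 0"
proof -
  assume "q i \<le> q j"
  let ?N = "Suc (max i j)"
  have "below i - below j = {y. i \<in> state ?N y \<and> j \<notin> state ?N y}"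
    using state_mono[of i ?N] state_mono[of j ?N] by auto
  then have "measure M (below i - below j) = measure P {x. i \<in> code ?N x \<and> j \<notin> code ?N x}"
    using measure_state[of "\<lambda>J. i \<in> J \<and> j \<notin> J" ?N] by simp
  also have "{x. i \<in> code ?N x \<and> j \<notin> code ?N x} = {}"
    using code_iff[of i ?N] code_iff[of j ?N] \<open>q i \<le> q j\<close> by auto
  finally show ?thesis by simp
qed

text \<open>The points whose decisions form a cut of the rationals with two nonempty parts, and so
  name a real number.\<close>

definition consistent :: "real set" where
  "consistent = {y. (\<forall>i j. q i \<le> q j \<longrightarrow> y \<in> below i \<longrightarrow> y \<in> below j) \<and>
     (\<exists>n. y \<in> below n) \<and> (\<exists>n. y \<notin> below n)}"

lemma total_mass: "measure P UNIV = measure M UNIV"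
  using dominated by (simp add: call_dominated_def)

lemma AE_consistent: "AE y in M. y \<in> consistent"
proof -
  have null: "AE y in M. y \<notin> A" if "A \<in> sets borel" "measure M A = 0" for A
    using that by (intro AE_not_in) (auto simp: null_sets_def emeasure_eq_measure)
  have "AE y in M. \<forall>i j. q i \<le> q j \<longrightarrow> y \<notin> below i - below j"
    unfolding AE_all_countable
  proof (intro allI)
    fix i j
    show "AE y in M. q i \<le> q j \<longrightarrow> y \<notin> below i - below j"
    proof (cases "q i \<le> q j")
      case True
      with null[of "below i - below j"] show ?thesis by (simp add: measure_below_diff)
    qed simp
  qed
  \<comment> \<open>A point below no threshold would be sent to infinity; the mass of such points is
    at most that of \<open>P\<close> above \<open>k\<close>, for every \<open>k\<close>.\<close>
  moreover have "AE y in M. y \<notin> (\<Inter>n. - below n)"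
  proof (rule null)
    have le: "measure M (\<Inter>n. - below n) \<le> measure M UNIV - cdf P (real k)" for k
    proof -
      have "real k \<in> range q" unfolding range_q by simp
      then obtain n where n: "q n = real k" by force
      have "measure M (\<Inter>n. - below n) \<le> measure M (- below n)"
        by (intro finite_measure_mono) auto
      then show ?thesis using measure_Compl[of "below n"] measure_below[of n] n by (simp add: cdf_def)
    qed
    have "(\<lambda>k. measure M UNIV - cdf P (real k)) \<longlonglongrightarrow> measure M UNIV - measure M UNIV"
      using P.cdf_lim_infty total_mass by (intro tendsto_diff) auto
    from LIMSEQ_le_const[OF this, of "measure M (\<Inter>n. - below n)"] le
    show "measure M (\<Inter>n. - below n) = 0" by (auto simp: measure_le_0_iff)
  qed (intro sets.countable_INT'', auto)
  moreover have "AE y in M. y \<notin> (\<Inter>n. below n)"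
  proof (rule null)
    have le: "measure M (\<Inter>n. below n) \<le> cdf P (- real k)" for k
    proof -
      have "- real k \<in> range q" unfolding range_q by simp
      then obtain n where n: "q n = - real k" by force
      have "measure M (\<Inter>n. below n) \<le> measure M (below n)"
        by (intro finite_measure_mono) auto
      then show ?thesis using measure_below[of n] n by (simp add: cdf_def)
    qed
    from LIMSEQ_le_const[OF P.cdf_lim_neg_infty, of "measure M (\<Inter>n. below n)"] le
    show "measure M (\<Inter>n. below n) = 0" by (auto simp: measure_le_0_iff)
  qed (intro sets.countable_INT'', auto)
  ultimately show ?thesis
    by eventually_elim (auto simp: consistent_def)
qed

lemma consistent_sets [measurable, simp]: "consistent \<in> sets borel"
proof -
  have "consistent = (\<Inter>i. \<Inter>j\<in>{j. q i \<le> q j}. - (below i - below j)) \<inter> (\<Union>n. below n) \<inter> (\<Union>n. - below n)"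
    unfolding consistent_def by auto
  also have "\<dots> \<in> sets borel"
    by (intro sets.Int sets.countable_INT'' sets.countable_UN) auto
  finally show ?thesis .
qed

text \<open>The value 0 off \<open>consistent\<close> is arbitrary: by \<open>AE_consistent\<close>
  it is taken there only on a null set, and it keeps the map Borel.\<close>

definition transport_map :: "real \<Rightarrow> real" where
  "transport_map y = (if y \<in> consistent then Inf (q ` {n. y \<in> below n}) else 0)"

text \<open>Only the strict inequality is described by the sets \<open>below n\<close>: if
  \<open>transport_map y = q n\<close>, then \<open>y\<close> lies in \<open>below n\<close> only
  when the infimum is attained. Hence the open half-lines in what follows.\<close>

lemma transport_map_less:
  assumes "y \<in> consistent"
  shows "transport_map y < x \<longleftrightarrow> (\<exists>n. q n < x \<and> y \<in> below n)"
proof -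
  obtain m where m: "y \<notin> below m" using assms by (auto simp: consistent_def)
  have mono: "q i \<le> q j \<Longrightarrow> y \<in> below i \<Longrightarrow> y \<in> below j" for i j
    using assms by (auto simp: consistent_def)
  have "bdd_below (q ` {n. y \<in> below n})"
    using mono m by (intro bdd_belowI[of _ "q m"]) (auto, metis linorder_le_cases)
  moreover have "q ` {n. y \<in> below n} \<noteq> {}"
    using assms by (auto simp: consistent_def)
  ultimately show ?thesis
    using assms by (auto simp: transport_map_def cInf_less_iff)
qed

lemma transport_map_measurable [measurable]: "transport_map \<in> borel_measurable borel"
proof (rule borel_measurableI_less)
  fix x
  have "{y. transport_map y < x} =
      (consistent \<inter> (\<Union>n\<in>{n. q n < x}. below n)) \<union> (if 0 < x then - consistent else {})"
    using transport_map_less by (auto simp: transport_map_def split: if_splits)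
  also have "\<dots> \<in> sets borel" by auto
  finally show "{y \<in> space borel. transport_map y < x} \<in> sets borel" by simp
qed

text \<open>For rational thresholds tending to \<open>x\<close> from below, the sets
  \<open>below (n k)\<close> converge to the preimage of \<open>{..<x}\<close> off a null set, and
  the half-lines \<open>{..q (n k)}\<close> converge to \<open>{..<x}\<close>. Dominated convergence
  applies on both sides.\<close>

lemma integral_transport_half:
  assumes g: "integrable M g" "integrable P g"
    and eq: "\<And>n. (LINT y:below n|M. g y) = (LINT x:{..q n}|P. g x)"
  shows "(LINT y:transport_map -` {..<x}|M. g y) = (LINT y:{..<x}|P. g y :: real)"
proof -
  have "\<exists>n. x - 1 / real (Suc k) < q n \<and> q n < x" for k
  proof -
    have "x - 1 / real (Suc k) < x" by simp
    from Rats_dense_in_real[OF this] obtain r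
      where "r \<in> range q" "x - 1 / real (Suc k) < r" "r < x"
      unfolding range_q by blast
    then show ?thesis by blast
  qed
  then have "\<forall>k. \<exists>n. x - 1 / real (Suc k) < q n \<and> q n < x" by blast
  from choice[OF this] obtain n
    where "\<forall>k. x - 1 / real (Suc k) < q (n k) \<and> q (n k) < x" ..
  then have n: "\<And>k. x - 1 / real (Suc k) < q (n k)" "\<And>k. q (n k) < x" by blast+
  have lim: "(\<lambda>k. q (n k)) \<longlonglongrightarrow> x"
  proof (rule tendsto_sandwich[OF _ _ _ tendsto_const])
    have "(\<lambda>k. x - 1 / real (Suc k)) \<longlonglongrightarrow> x - 0"
      by (intro tendsto_diff tendsto_const LIMSEQ_Suc[OF lim_1_over_n])
    then show "(\<lambda>k. x - 1 / real (Suc k)) \<longlonglongrightarrow> x" by simp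
  qed (use n in \<open>auto intro!: always_eventually less_imp_le\<close>)
  have "(\<lambda>k. LINT y:below (n k)|M. g y) \<longlonglongrightarrow> (LINT y:transport_map -` {..<x}|M. g y)"
    unfolding set_lebesgue_integral_def
  proof (rule integral_dominated_convergence[where w="\<lambda>y. \<bar>g y\<bar>"])
    show "AE y in M. (\<lambda>k. indicat_real (below (n k)) y *\<^sub>R g y) \<longlonglongrightarrow>
        indicat_real (transport_map -` {..<x}) y *\<^sub>R g y"
      using AE_consistent
    proof eventually_elim
      case (elim y)
      have "\<forall>\<^sub>F k in sequentially.
          indicat_real (below (n k)) y = indicat_real (transport_map -` {..<x}) y"
      proof (cases "transport_map y < x")
        case True
        then obtain i where i: "q i < x" "y \<in> below i"
          using transport_map_less[OF elim] by auto
        from order_tendstoD(1)[OF lim i(1)] show ?thesis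
        proof eventually_elim
          case (elim k)
          then have "y \<in> below (n k)"
            using i(2) \<open>y \<in> consistent\<close> by (auto simp: consistent_def intro: less_imp_le)
          then show ?case using True by simp
        qed
      next
        case False
        then have "y \<notin> below (n k)" for k
          using transport_map_less[OF elim] n(2)[of k] by auto
        with False show ?thesis by simp
      qed
      then show ?case by (intro tendsto_eventually) (auto elim: eventually_mono)
    qed
    show "integrable M (\<lambda>y. \<bar>g y\<bar>)" using g by auto
    have "transport_map -` {..<x} \<in> sets borel"
      using measurable_sets[OF transport_map_measurable, of "{..<x}"] by simp
    then show "(\<lambda>y. indicat_real (transport_map -` {..<x}) y *\<^sub>R g y) \<in> borel_measurable M"
      using g by auto
    show "(\<lambda>y. indicat_real (below (n k)) y *\<^sub>R g y) \<in> borel_measurable M" for k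
      using g by auto
  qed (auto simp: indicator_def)
  moreover have "(\<lambda>k. LINT y:{..q (n k)}|P. g y) \<longlonglongrightarrow> (LINT y:{..<x}|P. g y)"
    unfolding set_lebesgue_integral_def
  proof (rule integral_dominated_convergence[where w="\<lambda>y. \<bar>g y\<bar>"])
    show "AE y in P. (\<lambda>k. indicat_real {..q (n k)} y *\<^sub>R g y) \<longlonglongrightarrow> indicat_real {..<x} y *\<^sub>R g y"
    proof (rule AE_I2)
      fix y
      have "\<forall>\<^sub>F k in sequentially. indicat_real {..q (n k)} y = indicat_real {..<x} y"
      proof (cases "y < x")
        case True
        from order_tendstoD(1)[OF lim True] show ?thesis
          by eventually_elim (use True in auto)
      next
        case False
        then have "\<not> y \<le> q (n k)" for k using n(2)[of k] by auto
        with False show ?thesis by simp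
      qed
      then show "(\<lambda>k. indicat_real {..q (n k)} y *\<^sub>R g y) \<longlonglongrightarrow> indicat_real {..<x} y *\<^sub>R g y"
        by (intro tendsto_eventually) (auto elim: eventually_mono)
    qed
    show "integrable P (\<lambda>y. \<bar>g y\<bar>)" using g by auto
  qed (use g in \<open>auto simp: indicator_def\<close>)
  ultimately show ?thesis
    unfolding eq by (rule LIMSEQ_unique)
qed

lemma
  assumes "C \<in> sets borel"
  shows measure_transport_map: "measure M (transport_map -` C) = measure P C"
    and integral_transport_map: "(LINT y:transport_map -` C|M. y) = (LINT x:C|P. x)"
proof -
  have C: "transport_map -` C \<in> sets borel"
    using measurable_sets[OF transport_map_measurable assms] by simp
  have 1: "(LINT x:A|M. (1::real)) = measure M A" "(LINT x:A|P. (1::real)) = measure P A"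
    if "A \<in> sets borel" for A
    using that by (auto simp: set_integral_const emeasure_finite P.emeasure_finite)
  have "(LINT y:transport_map -` C|M. (1::real)) = (LINT x:C|P. 1)"
    by (rule set_integral_vimage_eqI[OF P.finite_mean_measure_axioms transport_map_measurable
          _ _ integral_transport_half _ assms]) (simp_all add: 1 measure_below total_mass)
  then show "measure M (transport_map -` C) = measure P C"
    using assms C by (simp add: 1)
  show "(LINT y:transport_map -` C|M. y) = (LINT x:C|P. x)"
  proof (rule set_integral_vimage_eqI[OF P.finite_mean_measure_axioms transport_map_measurable
        integrable_id P.integrable_id
        integral_transport_half[OF integrable_id P.integrable_id integral_below] _ assms])
    show "integral\<^sup>L M (\<lambda>y. y) = integral\<^sup>L P (\<lambda>x. x)"
      using dominated by (simp add: call_dominated_def set_integral_UNIV P.set_integral_UNIV)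
  qed
qed

end

text \<open>The first equation makes \<open>f\<close> push \<open>M\<close> on \<open>B\<close> to
  \<open>P\<close> on \<open>A\<close>; the second, for arbitrary \<open>C\<close>, is the
  martingale property in integrated form.\<close>

lemma (in atomless_mean_measure) transport_map_exists:
  assumes "finite_mean_measure P" "A \<in> sets borel" "B \<in> sets borel"
    and dom: "call_dominated P A M B"
  shows "\<exists>f\<in>borel_measurable borel. \<forall>C\<in>sets borel.
    measure M (B \<inter> f -` C) = measure P (A \<inter> C) \<and>
    (LINT y:B \<inter> f -` C|M. y) = (LINT x:A \<inter> C|P. x)"
proof -
  interpret P: finite_mean_measure P by fact
  let ?P = "density P (\<lambda>x. ennreal (indicat_real A x))"
  let ?M = "density M (\<lambda>x. ennreal (indicat_real B x))"
  have w: "weight (indicat_real A)" "weight (indicat_real B)"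
    using assms by (auto intro!: weightI[of _ 1] simp: indicator_def)
  interpret M': atomless_mean_measure ?M by (rule atomless_mean_density[OF w(2)])
  interpret P': finite_mean_measure ?P by (rule P.finite_mean_density[OF w(1)])
  interpret dominated_pair ?M ?P "from_nat_into \<rat>"
  proof
    show "range (from_nat_into \<rat>) = (\<rat> :: real set)"
      by (intro range_from_nat_into countable_rat) auto
    show "call_dominated ?P UNIV ?M UNIV"
      using dom assms by (simp add: call_dominated_def P.measure_restrict measure_restrict
          P.set_integral_restrict set_integral_restrict)
  qed
  have "transport_map -` C \<in> sets borel" if "C \<in> sets borel" for C
    using measurable_sets[OF transport_map_measurable that] by simp
  then show ?thesis
    using assms measure_transport_map integral_transport_map
    by (intro bexI[OF _ transport_map_measurable])
      (simp add: P.measure_restrict measure_restrict P.set_integral_restrict set_integral_restrict)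
qed

section \<open>Martingale couplings on a grid\<close>

lemma fst_borel [measurable]: "fst \<in> borel_measurable (borel :: (real \<times> real) measure)"
  and snd_borel [measurable]: "snd \<in> borel_measurable (borel :: (real \<times> real) measure)"
  by (auto intro!: borel_measurable_continuous_onI continuous_on_fst continuous_on_snd continuous_on_id)

lemma mono_nat_measurable:
  fixes f :: "real \<Rightarrow> nat"
  assumes "mono f"
  shows "f \<in> borel \<rightarrow>\<^sub>M count_space UNIV"
proof -
  have "is_interval {x. f x = i}" for i
    unfolding is_interval_1 using monoD[OF assms] by (metis mem_Collect_eq order_antisym)
  then have "{x. f x = i} \<in> sets borel" for i
    by (intro real_interval_borel_measurable)
  then show ?thesis
    by (subst measurable_count_space_eq_countable) (auto simp: vimage_def)
qed

lemma borel_prob_fm_finite_mean: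
  assumes "\<mu> \<in> borel_prob_fm"
  shows "finite_mean_measure \<mu>"
proof -
  interpret prob_space \<mu> using assms by (simp add: borel_prob_fm_def)
  show ?thesis
    using assms by unfold_locales (auto simp: borel_prob_fm_def)
qed

lemma borel_prob_fm_atomless_mean:
  assumes "\<nu> \<in> borel_prob_fm" "atomless \<nu>"
  shows "atomless_mean_measure \<nu>"
  using assms borel_prob_fm_finite_mean[OF assms(1)]
  by (auto simp: atomless_mean_measure_def atomless_mean_measure_axioms_def atomless_def measure_def)

locale coupling =
  fixes \<mu> \<nu> :: "real measure" and \<pi> :: "(real \<times> real) measure"
  assumes \<mu>: "\<mu> \<in> borel_prob_fm" and \<nu>: "\<nu> \<in> borel_prob_fm"
    and prob: "prob_space \<pi>" and sets_\<pi> [measurable_cong]: "sets \<pi> = sets borel"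
    and distr_fst: "distr \<pi> borel fst = \<mu>" and distr_snd: "distr \<pi> borel snd = \<nu>"
begin

sublocale prob_space \<pi> by (rule prob)

sublocale X: finite_mean_measure \<mu> by (rule borel_prob_fm_finite_mean[OF \<mu>])

sublocale Y: finite_mean_measure \<nu> by (rule borel_prob_fm_finite_mean[OF \<nu>])

lemma space_\<pi> [simp]: "space \<pi> = UNIV"
  using sets_eq_imp_space_eq[OF sets_\<pi>] by simp

lemma vimage_fst_sets [measurable]: "A \<in> sets borel \<Longrightarrow> fst -` A \<in> sets \<pi>"
  and vimage_snd_sets [measurable]: "A \<in> sets borel \<Longrightarrow> snd -` A \<in> sets \<pi>"
  using measurable_sets[OF fst_borel, of A] measurable_sets[OF snd_borel, of A] by (auto simp: sets_\<pi>)

lemma integral_fst: "f \<in> borel_measurable borel \<Longrightarrow> (\<integral>z. f (fst z) \<partial>\<pi>) = (\<integral>x. f x \<partial>\<mu> :: real)"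
  unfolding distr_fst[symmetric] by (subst integral_distr) auto

lemma integral_snd: "f \<in> borel_measurable borel \<Longrightarrow> (\<integral>z. f (snd z) \<partial>\<pi>) = (\<integral>y. f y \<partial>\<nu> :: real)"
  unfolding distr_snd[symmetric] by (subst integral_distr) auto

lemma integrable_fst: "integrable \<mu> f \<Longrightarrow> integrable \<pi> (\<lambda>z. f (fst z) :: real)"
  using integrable_distr[of fst \<pi> borel f] by (simp add: distr_fst)

lemma integrable_snd: "integrable \<nu> f \<Longrightarrow> integrable \<pi> (\<lambda>z. f (snd z) :: real)"
  using integrable_distr[of snd \<pi> borel f] by (simp add: distr_snd)

lemma set_integrable_\<pi>: "integrable \<pi> f \<Longrightarrow> A \<in> sets \<pi> \<Longrightarrow> set_integrable \<pi> A (f :: _ \<Rightarrow> real)"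
  unfolding set_integrable_def by (intro integrable_mult_indicator)

lemma set_integral_fst:
  assumes "f \<in> borel_measurable borel" "A \<in> sets borel"
  shows "(LINT z:fst -` A|\<pi>. f (fst z)) = (LINT x:A|\<mu>. f x :: real)"
  using integral_fst[of "\<lambda>x. indicator A x *\<^sub>R f x"] assms
  unfolding set_lebesgue_integral_def by (simp add: indicator_vimage)

lemma measure_fst: "A \<in> sets borel \<Longrightarrow> measure \<pi> (fst -` A) = measure \<mu> A"
  unfolding distr_fst[symmetric] by (subst measure_distr) auto

lemma measure_snd: "A \<in> sets borel \<Longrightarrow> measure \<pi> (snd -` A) = measure \<nu> A"
  unfolding distr_snd[symmetric] by (subst measure_distr) auto

lemma subalgebra_fst: "subalgebra \<pi> (vimage_algebra (space \<pi>) fst borel)"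
  by (auto simp: subalgebra_def sets_vimage_algebra2)

text \<open>The sigma-algebra generated by \<open>fst\<close> consists of the preimages of Borel
  sets, and \<open>fst\<close> is measurable for it, so conditional expectation is characterised by
  integrals over these sets. The couplings below are handled in this integrated form.\<close>

lemma cond_exp_iff:
  "(AE z in \<pi>. real_cond_exp \<pi> (vimage_algebra (space \<pi>) fst borel) snd z = fst z) \<longleftrightarrow>
   (\<forall>A\<in>sets borel. (LINT z:fst -` A|\<pi>. snd z) = (LINT z:fst -` A|\<pi>. fst z))"
proof -
  let ?F = "vimage_algebra (space \<pi>) fst (borel :: real measure)"
  interpret F: finite_measure_subalgebra \<pi> ?F
    by unfold_locales (rule subalgebra_fst)
  have sets_F: "sets ?F = {fst -` A |A. A \<in> sets borel}"
    by (simp add: sets_vimage_algebra2)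
  have int: "integrable \<pi> fst" "integrable \<pi> snd"
    using integrable_fst[OF X.integrable_id] integrable_snd[OF Y.integrable_id] by auto
  show ?thesis
  proof (intro iffI ballI)
    fix A :: "real set" assume AE: "AE z in \<pi>. real_cond_exp \<pi> ?F snd z = fst z" and A: "A \<in> sets borel"
    have "(LINT z:fst -` A|\<pi>. snd z) = (LINT z:fst -` A|\<pi>. real_cond_exp \<pi> ?F snd z)"
      using A sets_F by (intro F.real_cond_exp_intA int) auto
    also have "\<dots> = (LINT z:fst -` A|\<pi>. fst z)"
      unfolding set_lebesgue_integral_def using AE A
      by (intro integral_cong_AE) auto
    finally show "(LINT z:fst -` A|\<pi>. snd z) = (LINT z:fst -` A|\<pi>. fst z)" .
  next
    assume *: "\<forall>A\<in>sets borel. (LINT z:fst -` A|\<pi>. snd z) = (LINT z:fst -` A|\<pi>. fst z)"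
    show "AE z in \<pi>. real_cond_exp \<pi> ?F snd z = fst z"
    proof (rule F.real_cond_exp_charact)
      show "fst \<in> borel_measurable ?F"
        by (rule measurable_vimage_algebra1) simp
    qed (use * sets_F int in auto)
  qed
qed

end

locale martingale_coupling = coupling +
  assumes martingale: "A \<in> sets borel \<Longrightarrow> (LINT z:fst -` A|\<pi>. snd z) = (LINT z:fst -` A|\<pi>. fst z)"
begin

text \<open>On \<open>A \<inter> {k<..}\<close> the call of the first coordinate is affine, so the
  martingale property exchanges the coordinates there; passing to the call of the second coordinate
  and to all of \<open>A\<close> only enlarges the integral.\<close>

lemma conditional_jensen_call:
  assumes A: "A \<in> sets borel"
  shows "(LINT x:A|\<mu>. max 0 (x - k)) \<le> (LINT z:fst -` A|\<pi>. max 0 (snd z - k))"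
proof -
  let ?B = "A \<inter> {k<..}"
  have B: "?B \<in> sets borel" "fst -` ?B \<in> sets \<pi>" "fst -` A \<in> sets \<pi>"
    using A vimage_fst_sets[of ?B] vimage_fst_sets[of A] by auto
  have k: "integrable \<pi> (\<lambda>z. k)" by simp
  have int: "set_integrable \<pi> C (\<lambda>z. fst z)" "set_integrable \<pi> C (\<lambda>z. snd z)"
    "set_integrable \<pi> C (\<lambda>z. max 0 (snd z - k))" "set_integrable \<pi> C (\<lambda>z. k)" if "C \<in> sets \<pi>" for C
    using that integrable_fst[OF X.integrable_id] integrable_snd[OF Y.integrable_id]
      integrable_snd[OF Y.integrable_call, of k] k
    by (auto intro: set_integrable_\<pi>)
  have "(LINT x:A|\<mu>. max 0 (x - k)) = (LINT x:?B|\<mu>. x - k)"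
    unfolding set_lebesgue_integral_def
    by (intro Bochner_Integration.integral_cong) (auto simp: indicator_def)
  also have "\<dots> = (LINT z:fst -` ?B|\<pi>. fst z - k)"
    using B by (intro set_integral_fst[symmetric]) auto
  also have "\<dots> = (LINT z:fst -` ?B|\<pi>. snd z - k)"
    using martingale[OF B(1)] int[OF B(2)] by (simp add: set_integral_diff del: vimage_Int)
  also have "\<dots> \<le> (LINT z:fst -` ?B|\<pi>. max 0 (snd z - k))"
    using B int by (intro set_integral_mono set_integral_diff) auto
  also have "\<dots> \<le> (LINT z:fst -` A|\<pi>. max 0 (snd z - k))"
    using int(3)[OF B(2)] int(3)[OF B(3)] unfolding set_lebesgue_integral_def set_integrable_def
    by (intro integral_mono) (auto simp: indicator_def)
  finally show ?thesis .
qed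

end

lemma martingale_transports_iff:
  assumes "\<mu> \<in> borel_prob_fm" "\<nu> \<in> borel_prob_fm"
  shows "\<pi> \<in> martingale_transports \<mu> \<nu> \<longleftrightarrow> martingale_coupling \<mu> \<nu> \<pi>"
proof
  assume \<pi>: "\<pi> \<in> martingale_transports \<mu> \<nu>"
  interpret coupling \<mu> \<nu> \<pi>
    using \<pi> assms by (intro coupling.intro) (auto simp: martingale_transports_def)
  show "martingale_coupling \<mu> \<nu> \<pi>"
    using \<pi> cond_exp_iff
    by (intro martingale_coupling.intro coupling_axioms martingale_coupling_axioms.intro)
      (auto simp: martingale_transports_def)
next
  assume "martingale_coupling \<mu> \<nu> \<pi>"
  then interpret martingale_coupling \<mu> \<nu> \<pi> .
  show "\<pi> \<in> martingale_transports \<mu> \<nu>"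
    using cond_exp_iff martingale prob_space_axioms
    by (auto simp: martingale_transports_def sets_\<pi> distr_fst distr_snd)
qed

text \<open>The same cells serve both axes, since label i, a cell of the first coordinate, makes its
  demand in cell i of the second. Monotonicity of \<open>cell\<close> orders the cells from left to
  right.\<close>

locale gridded_coupling = martingale_coupling +
  fixes cell :: "real \<Rightarrow> nat" and n :: nat
  assumes mono_cell: "mono cell" and cell_less: "cell x < n"
    and atomless_\<nu>: "atomless \<nu>"
begin

lemma cell_measurable [measurable]: "cell \<in> borel \<rightarrow>\<^sub>M count_space UNIV"
  by (rule mono_nat_measurable[OF mono_cell])

sublocale Y: gridded_measure \<nu> cell
  using borel_prob_fm_atomless_mean[OF \<nu> atomless_\<nu>] cell_measurable
  by (simp add: gridded_measure_def gridded_measure_axioms_def)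

abbreviation part :: "nat \<Rightarrow> real set" where
  "part i \<equiv> {x. cell x = i}"

lemma part_sets: "part i \<in> sets borel" by simp

text \<open>The conditional probabilities of the strips \<open>fst z \<in> part i\<close> given the
  second coordinate, obtained as Radon-Nikodym derivatives. They sum to 1 because the strips cover
  the plane.\<close>

lemma density_exists:
  obtains h where "\<And>i. weight (h i)" "AE y in \<nu>. (\<Sum>i<n. h i y) = 1"
    "\<And>i f. i < n \<Longrightarrow> integrable \<nu> f \<Longrightarrow> (\<integral>y. h i y * f y \<partial>\<nu>) = (LINT z:fst -` part i|\<pi>. f (snd z))"
proof -
  define D where "D i = density \<pi> (indicator (fst -` part i))" for i
  define N where "N i = distr (D i) borel snd" for i
  have emeasure_N: "emeasure (N i) C = emeasure \<pi> (fst -` part i \<inter> snd -` C)" if "C \<in> sets borel" for i C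
  proof -
    have "emeasure (N i) C = emeasure (D i) (snd -` C)"
      unfolding N_def using that by (subst emeasure_distr) (auto simp: D_def)
    also have "\<dots> = emeasure \<pi> (fst -` part i \<inter> snd -` C)"
      unfolding D_def using that part_sets by (intro emeasure_restricted) auto
    finally show ?thesis .
  qed
  have sets_N: "sets (N i) = sets \<nu>" for i by (simp add: N_def)
  have ac: "absolutely_continuous \<nu> (N i)" for i
    unfolding absolutely_continuous_def
  proof
    fix C assume C: "C \<in> null_sets \<nu>"
    then have "C \<in> sets borel" by auto
    then have "emeasure \<pi> (snd -` C) = 0"
      using measure_snd[of C] C by (simp add: emeasure_eq_measure null_sets_def Y.emeasure_eq_measure)
    moreover have "emeasure \<pi> (fst -` part i \<inter> snd -` C) \<le> emeasure \<pi> (snd -` C)"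
      using \<open>C \<in> sets borel\<close> by (intro emeasure_mono) auto
    ultimately show "C \<in> null_sets (N i)"
      using emeasure_N[OF \<open>C \<in> sets borel\<close>] \<open>C \<in> sets borel\<close> by (auto simp: null_sets_def sets_N)
  qed
  define r where "r i = RN_deriv \<nu> (N i)" for i
  have r_measurable [measurable]: "r i \<in> borel_measurable borel" for i
    unfolding r_def using borel_measurable_RN_deriv[of \<nu> "N i"] by simp
  have density_r: "density \<nu> (r i) = N i" for i
    unfolding r_def using ac sets_N by (intro Y.density_RN_deriv)
  have "density \<nu> (\<lambda>y. \<Sum>i<n. r i y) = density \<nu> (\<lambda>_. 1)"
  proof (rule measure_eqI)
    fix C assume "C \<in> sets (density \<nu> (\<lambda>y. \<Sum>i<n. r i y))"
    then have C: "C \<in> sets borel" by simp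
    have "emeasure (density \<nu> (\<lambda>y. \<Sum>i<n. r i y)) C = (\<integral>\<^sup>+y. (\<Sum>i<n. r i y * indicator C y) \<partial>\<nu>)"
      unfolding sum_distrib_right[symmetric] using C by (intro emeasure_density) auto
    also have "\<dots> = (\<Sum>i<n. \<integral>\<^sup>+y. r i y * indicator C y \<partial>\<nu>)"
      using C by (intro nn_integral_sum) auto
    also have "\<dots> = (\<Sum>i<n. emeasure (density \<nu> (r i)) C)"
      using C by (simp add: emeasure_density)
    also have "\<dots> = (\<Sum>i<n. emeasure \<pi> (fst -` part i \<inter> snd -` C))"
      using C by (simp add: density_r emeasure_N)
    also have "\<dots> = emeasure \<pi> (\<Union>i<n. fst -` part i \<inter> snd -` C)"
      using C part_sets by (intro sum_emeasure) (auto simp: disjoint_family_on_def)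
    also have "(\<Union>i<n. fst -` part i \<inter> snd -` C) = snd -` C"
      using cell_less by auto
    also have "emeasure \<pi> (snd -` C) = emeasure \<nu> C"
      using measure_snd[OF C] by (simp add: emeasure_eq_measure Y.emeasure_eq_measure)
    finally show "emeasure (density \<nu> (\<lambda>y. \<Sum>i<n. r i y)) C = emeasure (density \<nu> (\<lambda>_. 1)) C"
      using C by (simp add: emeasure_density)
  qed simp
  then have r_sum: "AE y in \<nu>. (\<Sum>i<n. r i y) = 1"
    by (intro Y.density_unique) auto
  \<comment> \<open>The truncation makes a bounded real weight everywhere; since the first
    \<open>n\<close> derivatives sum to 1 almost everywhere, it changes these only on a null
    set.\<close>
  define h where "h i y = min 1 (enn2real (r i y))" for i y
  have r_h: "AE y in \<nu>. \<forall>i<n. r i y = ennreal (h i y)"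
    using r_sum
  proof eventually_elim
    case (elim y)
    show ?case
    proof (intro allI impI)
      fix i assume "i < n"
      then have "r i y \<le> (\<Sum>i<n. r i y)" by (intro member_le_sum) auto
      then have "r i y \<le> 1" using elim by simp
      then show "r i y = ennreal (h i y)"
        by (cases "r i y") (auto simp: h_def min_def top_unique)
    qed
  qed
  have w: "weight (h i)" for i
    unfolding h_def[abs_def] by (intro weightI[of _ 1]) auto
  show thesis
  proof
    show "AE y in \<nu>. (\<Sum>i<n. h i y) = 1"
      using r_sum r_h
    proof eventually_elim
      case (elim y)
      then have "ennreal (\<Sum>i<n. h i y) = ennreal 1"
        by (simp add: weight_nonneg[OF w] flip: sum_ennreal)
      then show ?case by (subst (asm) ennreal_inj) (auto intro: sum_nonneg weight_nonneg[OF w])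
    qed
    fix i and f :: "real \<Rightarrow> real" assume i: "i < n" and f: "integrable \<nu> f"
    have f' [measurable]: "f \<in> borel_measurable borel" using f by auto
    have "density \<nu> (\<lambda>y. ennreal (h i y)) = N i"
      unfolding density_r[symmetric] using r_h i w[of i] by (intro density_cong) (auto simp: weight_measurable)
    then have "(\<integral>y. h i y * f y \<partial>\<nu>) = (\<integral>y. f y \<partial>N i)"
      using Y.integral_density_weight[OF w f', of i] by simp
    also have "\<dots> = (\<integral>z. f (snd z) \<partial>D i)"
      unfolding N_def by (subst integral_distr) (auto simp: D_def)
    also have "\<dots> = (\<integral>z. f (snd z) \<partial>density \<pi> (\<lambda>z. ennreal (indicat_real (fst -` part i) z)))"
      unfolding D_def ennreal_indicator ..
    also have "\<dots> = (LINT z:fst -` part i|\<pi>. f (snd z))"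
      unfolding set_lebesgue_integral_def
      by (subst integral_density) (auto simp: vimage_fst_sets)
    finally show "(\<integral>y. h i y * f y \<partial>\<nu>) = (LINT z:fst -` part i|\<pi>. f (snd z))" .
  qed (rule w)
qed

end

context gridded_coupling
begin

lemma integral_eq_sum_cells:
  assumes "weight u" "integrable \<nu> f"
  shows "(\<integral>y. u y * f y \<partial>\<nu>) = (\<Sum>l<n. Y.cell_integral l u f)"
proof -
  have int: "integrable \<nu> (\<lambda>y. u y * indicat_real (part l) y * f y)" for l
    using assms by (intro Y.weight_times_integrable weight_indicator) auto
  have "(\<Sum>l<n. u y * indicat_real (part l) y * f y) = u y * f y" for y
  proof -
    have "(\<Sum>l<n. u y * indicat_real (part l) y * f y) = (\<Sum>l<n. if l = cell y then u y * f y else 0)"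
      by (intro sum.cong) (auto simp: indicator_def)
    then show ?thesis using cell_less[of y] by simp
  qed
  then have "(\<integral>y. u y * f y \<partial>\<nu>) = (\<integral>y. (\<Sum>l<n. u y * indicat_real (part l) y * f y) \<partial>\<nu>)"
    by simp
  also have "\<dots> = (\<Sum>l<n. Y.cell_integral l u f)"
    unfolding Y.cell_integral_def using int by (intro Bochner_Integration.integral_sum) auto
  finally show ?thesis .
qed

text \<open>For \<open>k\<close> between two points of the \<open>i\<close>-th cell, \<open>max 0 (y - k)\<close> is affine in \<open>y\<close> on every other
  cell, and for all remaining \<open>k\<close> the call inequality is Jensen's inequality. Hence spreading the
  \<open>i\<close>-th density inside its own cell is all that is needed.\<close>

lemma partition_exists:
  obtains b where "b \<in> borel \<rightarrow>\<^sub>M count_space UNIV" "\<And>y. b y < n"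
    "\<And>i. i < n \<Longrightarrow> call_dominated \<mu> (part i) \<nu> {y. b y = i}"
    "\<And>i j. i < n \<Longrightarrow> measure \<nu> ({y. b y = i} \<inter> part j) = measure \<pi> (fst -` part i \<inter> snd -` part j)"
proof -
  obtain h where w: "\<And>i. weight (h i)" and sum_h: "AE y in \<nu>. (\<Sum>i<n. h i y) = 1"
    and h: "\<And>i f. i < n \<Longrightarrow> integrable \<nu> f \<Longrightarrow>
      (\<integral>y. h i y * f y \<partial>\<nu>) = (LINT z:fst -` part i|\<pi>. f (snd z))"
    by (rule density_exists) blast
  have "0 < n" using cell_less[of 0] by simp
  from Y.partition_separation[OF this, of h] w obtain b where
    b: "b \<in> borel \<rightarrow>\<^sub>M count_space UNIV" "\<And>y. b y < n" and
    spreads: "\<And>i. i < n \<Longrightarrow> Y.spreads i (h i) (\<lambda>y. (\<Sum>j<n. h j y) * indicat_real {y. b y = i} y)"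
    by blast
  \<comment> \<open>As the densities sum to 1, \<open>v i\<close> is almost everywhere just the
    indicator of class i.\<close>
  define v where "v i y = (\<Sum>j<n. h j y) * indicat_real {y. b y = i} y" for i y
  have B: "{y. b y = i} \<in> sets borel" for i
    using measurable_sets[OF b(1), of "{i}"] by (simp add: vimage_def)
  have wv: "weight (v i)" for i
    unfolding v_def[abs_def] using w B by (intro weight_indicator weight_sum)
  have v_integral: "(\<integral>y. v i y * f y \<partial>\<nu>) = (LINT y:{y. b y = i}|\<nu>. f y)"
    if "f \<in> borel_measurable borel" for f :: "real \<Rightarrow> real" and i
    unfolding set_lebesgue_integral_def
  proof (rule integral_cong_AE)
    show "AE y in \<nu>. v i y * f y = indicat_real {y. b y = i} y *\<^sub>R f y"
      using sum_h by eventually_elim (simp add: v_def)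
  qed (use that wv B in \<open>auto simp: weight_measurable\<close>)
  have cell_indicator: "Y.cell_integral l u f = (\<integral>y. u y * (indicat_real (part l) y * f y) \<partial>\<nu>)" for l u f
    by (simp add: Y.cell_integral_def mult.assoc)
  have moments: "(\<lambda>_. 1) \<in> Y.moments" "(\<lambda>x. x) \<in> Y.moments"
    by (auto simp: Y.moments_def)
  have v_eq: "v i = (\<lambda>y. (\<Sum>j<n. h j y) * indicat_real {y. b y = i} y)" for i
    by (simp add: v_def fun_eq_iff)
  have same: "Y.cell_integral l (h i) f = Y.cell_integral l (v i) f" if "i < n" "f \<in> Y.moments" for i l f
    using spreads[OF that(1)] that(2) by (simp add: Y.spreads_def v_eq)
  have larger: "Y.cell_integral i (h i) (\<lambda>x. max 0 (x - k)) \<le> Y.cell_integral i (v i) (\<lambda>x. max 0 (x - k))"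
    if "i < n" for i k
    using spreads[OF that(1)] by (simp add: Y.spreads_def v_eq)
  have same_total: "(LINT z:fst -` part i|\<pi>. f (snd z)) = (LINT y:{y. b y = i}|\<nu>. f y)"
    if i: "i < n" and f: "f \<in> Y.moments" for i f
  proof -
    have f': "integrable \<nu> f" "f \<in> borel_measurable borel"
      using Y.integrable_moments[OF f] by auto
    have "(LINT z:fst -` part i|\<pi>. f (snd z)) = (\<Sum>l<n. Y.cell_integral l (h i) f)"
      using h[OF i f'(1)] integral_eq_sum_cells[OF w f'(1)] by simp
    also have "\<dots> = (\<Sum>l<n. Y.cell_integral l (v i) f)"
      using same[OF i f] by simp
    also have "\<dots> = (LINT y:{y. b y = i}|\<nu>. f y)"
      using v_integral[OF f'(2)] integral_eq_sum_cells[OF wv f'(1)] by simp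
    finally show ?thesis .
  qed
  have 1: "(LINT y:A|\<nu>. 1) = measure \<nu> A" "(LINT x:A|\<mu>. 1) = measure \<mu> A"
    if "A \<in> sets borel" for A
    using that by (auto simp: set_integral_const Y.emeasure_finite X.emeasure_finite)
  have one: "(LINT z:A|\<pi>. 1) = measure \<pi> A" if "A \<in> sets \<pi>" for A
    using that by (auto simp: set_integral_const emeasure_finite)
  show thesis
  proof (rule that[OF b])
    fix i j assume i: "i < n"
    have "measure \<nu> ({y. b y = i} \<inter> part j) = (LINT y:{y. b y = i}|\<nu>. indicat_real (part j) y * 1)"
      using B[of i] by (simp add: set_lebesgue_integral_def flip: indicator_inter_arith)
    also have "\<dots> = Y.cell_integral j (v i) (\<lambda>_. 1)"
      unfolding cell_indicator by (intro v_integral[symmetric]) auto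
    also have "\<dots> = Y.cell_integral j (h i) (\<lambda>_. 1)"
      using same[OF i moments(1)] by simp
    also have "\<dots> = (LINT z:fst -` part i|\<pi>. indicat_real (part j) (snd z) * 1)"
      unfolding cell_indicator using Y.set_integrable[of "\<lambda>_. 1" "part j"]
      by (intro h i) (simp add: set_integrable_def)
    also have "\<dots> = (\<integral>z. indicat_real (fst -` part i \<inter> snd -` part j) z \<partial>\<pi>)"
      unfolding set_lebesgue_integral_def
      by (intro Bochner_Integration.integral_cong) (auto simp: indicator_def)
    also have "\<dots> = measure \<pi> (fst -` part i \<inter> snd -` part j)"
      by simp
    finally show "measure \<nu> ({y. b y = i} \<inter> part j) = measure \<pi> (fst -` part i \<inter> snd -` part j)" .
  next
    fix i assume i: "i < n"
    have mass: "measure \<mu> (part i) = measure \<nu> {y. b y = i}"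
      using same_total[OF i moments(1)] one[of "fst -` part i"] 1[OF B[of i]] measure_fst[OF part_sets, of i]
        vimage_fst_sets[OF part_sets, of i]
      by simp
    have "(LINT x:part i|\<mu>. x) = (LINT z:fst -` part i|\<pi>. fst z)"
      by (intro set_integral_fst[symmetric] part_sets) auto
    also have "\<dots> = (LINT z:fst -` part i|\<pi>. snd z)"
      by (intro martingale[symmetric] part_sets)
    also have "\<dots> = (LINT y:{y. b y = i}|\<nu>. y)"
      using same_total[OF i moments(2)] .
    finally have mean: "(LINT x:part i|\<mu>. x) = (LINT y:{y. b y = i}|\<nu>. y)" .
    have "(LINT x:part i|\<mu>. max 0 (x - k)) \<le> (LINT y:{y. b y = i}|\<nu>. max 0 (y - k))" for k
    proof -
      consider "\<And>x. x \<in> part i \<Longrightarrow> k < x" | "\<And>x. x \<in> part i \<Longrightarrow> x < k"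
        | x1 x2 where "x1 \<in> part i" "x2 \<in> part i" "x1 \<le> k" "k \<le> x2"
        by (meson not_less)
      then show ?thesis
      proof cases
        case 1
        have "(LINT x:part i|\<mu>. max 0 (x - k)) = - k * measure \<mu> (part i) + 1 * (LINT x:part i|\<mu>. x)"
          using 1 by (intro X.set_integral_eq_affine part_sets) (auto simp: indicator_def dest!: 1)
        also have "\<dots> \<le> (LINT y:{y. b y = i}|\<nu>. max 0 (y - k))"
          using Y.set_integral_ge_affine_call[OF B, of i k] mass mean by simp
        finally show ?thesis .
      next
        case 2
        have "(LINT x:part i|\<mu>. max 0 (x - k)) = 0"
          unfolding set_lebesgue_integral_def using 2
          by (intro integral_eq_zero_AE AE_I2) (auto simp: indicator_def less_imp_le)
        also have "0 \<le> (LINT y:{y. b y = i}|\<nu>. max 0 (y - k))"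
          unfolding set_lebesgue_integral_def by (intro integral_nonneg_AE) auto
        finally show ?thesis .
      next
        case 3
        let ?c = "\<lambda>y. max 0 (y - k) :: real"
        have c: "integrable \<nu> ?c" by (rule Y.integrable_call)
        have le: "Y.cell_integral l (h i) ?c \<le> Y.cell_integral l (v i) ?c" for l
        proof -
          consider "l = i" | "l < i" | "i < l" by linarith
          then show ?thesis
          proof cases
            case 1
            then show ?thesis using larger[OF i] by simp
          next
            case 2
            have "y \<le> k" if "cell y = l" for y
              using that 2 3 monoD[OF mono_cell, of x1 y] by (cases "x1 \<le> y") auto
            then have "Y.cell_integral l u ?c = 0" for u
              unfolding Y.cell_integral_def
              by (intro integral_eq_zero_AE AE_I2) (auto simp: indicator_def)
            then show ?thesis by simp
          next
            case l: 3
            have "k \<le> y" if "cell y = l" for y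
              using that l 3 monoD[OF mono_cell, of y x2] by (cases "y \<le> x2") auto
            then have eq: "Y.cell_integral l u ?c =
                Y.cell_integral l u (\<lambda>x. x) - k * Y.cell_integral l u (\<lambda>_. 1)" if "weight u" for u
            proof -
              have int: "integrable \<nu> (\<lambda>y. u y * indicat_real (part l) y * f y)"
                if "f \<in> Y.moments" for f
                using that \<open>weight u\<close>
                by (intro Y.weight_times_integrable weight_indicator Y.integrable_moments) auto
              have "Y.cell_integral l u ?c = (\<integral>y. u y * indicat_real (part l) y * y -
                  k * (u y * indicat_real (part l) y * 1) \<partial>\<nu>)"
                unfolding Y.cell_integral_def using \<open>\<And>y. cell y = l \<Longrightarrow> k \<le> y\<close>
                by (intro Bochner_Integration.integral_cong refl) (auto simp: indicator_def algebra_simps)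
              also have "\<dots> = Y.cell_integral l u (\<lambda>x. x) - k * Y.cell_integral l u (\<lambda>_. 1)"
                unfolding Y.cell_integral_def using int[OF moments(1)] int[OF moments(2)]
                by (subst Bochner_Integration.integral_diff) (auto simp del: mult_1_right)
              finally show ?thesis .
            qed
            show ?thesis
              using eq[OF w] eq[OF wv] same[OF i moments(1)] same[OF i moments(2)] by simp
          qed
        qed
        \<comment> \<open>Two comparisons are chained: the conditional Jensen inequality from \<mu>
          to the density \<open>h i\<close>, then spreading from \<open>h i\<close> to the indicator
          \<open>v i\<close>.\<close>
        have "(LINT x:part i|\<mu>. ?c x) \<le> (LINT z:fst -` part i|\<pi>. ?c (snd z))"
          by (intro conditional_jensen_call part_sets)
        also have "\<dots> = (\<Sum>l<n. Y.cell_integral l (h i) ?c)"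
          using h[OF i c] integral_eq_sum_cells[OF w c] by simp
        also have "\<dots> \<le> (\<Sum>l<n. Y.cell_integral l (v i) ?c)"
          by (intro sum_mono le)
        also have "\<dots> = (LINT y:{y. b y = i}|\<nu>. ?c y)"
          using v_integral[of ?c] integral_eq_sum_cells[OF wv c] by simp
        finally show ?thesis .
      qed
    qed
    with mass mean show "call_dominated \<mu> (part i) \<nu> {y. b y = i}"
      by (simp add: call_dominated_def)
  qed
qed

text \<open>The maps for the separate classes are glued along \<open>b\<close>. Each sends its class
  back into its own cell almost everywhere, so the cell of the image is \<open>b y\<close>, and the
  rectangle masses are those of \<open>partition_exists\<close>.\<close>

lemma monge_transport_exists:
  obtains \<pi>' where "\<pi>' \<in> monge_martingale_transports \<mu> \<nu>"
    "\<And>i j. measure \<pi>' (fst -` part i \<inter> snd -` part j) = measure \<pi> (fst -` part i \<inter> snd -` part j)"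
proof -
  obtain b where b: "b \<in> borel \<rightarrow>\<^sub>M count_space UNIV" "\<And>y. b y < n"
    and dom: "\<And>i. i < n \<Longrightarrow> call_dominated \<mu> (part i) \<nu> {y. b y = i}"
    and mass: "\<And>i j. i < n \<Longrightarrow>
      measure \<nu> ({y. b y = i} \<inter> part j) = measure \<pi> (fst -` part i \<inter> snd -` part j)"
    by (rule partition_exists) blast
  define B where "B i = {y. b y = i}" for i
  have B: "B i \<in> sets borel" for i
    unfolding B_def using measurable_sets[OF b(1), of "{i}"] by (simp add: vimage_def)
  define Q where "Q i f \<longleftrightarrow> f \<in> borel_measurable borel \<and> (\<forall>C\<in>sets borel.
      measure \<nu> (B i \<inter> f -` C) = measure \<mu> (part i \<inter> C) \<and>
      (LINT y:B i \<inter> f -` C|\<nu>. y) = (LINT x:part i \<inter> C|\<mu>. x))" for i f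
  have "\<exists>f. Q i f" if "i < n" for i
    using Y.transport_map_exists[OF X.finite_mean_measure_axioms part_sets B, of i i] dom[OF that]
    by (auto simp: Q_def B_def)
  then have "\<forall>i. \<exists>f. i < n \<longrightarrow> Q i f" by blast
  from choice[OF this] obtain F where "\<forall>i. i < n \<longrightarrow> Q i (F i)" ..
  then have Q: "Q i (F i)" if "i < n" for i using that by blast
  define f where "f y = F (b y) y" for y
  have F: "F i \<in> borel_measurable borel" if "i < n" for i
    using Q[OF that] by (simp add: Q_def)
  have f_vimage: "f -` C = (\<Union>i<n. B i \<inter> F i -` C)" for C
    using b(2) by (auto simp: f_def B_def)
  have BF: "B i \<inter> F i -` C \<in> sets borel" if "i < n" "C \<in> sets borel" for i C
    using measurable_sets[OF F[OF that(1)] that(2)] B by auto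
  have f [measurable]: "f \<in> borel_measurable borel"
  proof (rule measurableI)
    fix C :: "real set" assume "C \<in> sets borel"
    then show "f -` C \<inter> space borel \<in> sets borel"
      using BF unfolding f_vimage by auto
  qed simp
  have disj: "disjoint_family_on (\<lambda>i. B i \<inter> F i -` C) {..<n}"
    "disjoint_family_on (\<lambda>i. part i \<inter> C) {..<n}" for C
    by (auto simp: disjoint_family_on_def B_def)
  have part_UN: "C = (\<Union>i<n. part i \<inter> C)" for C
    using cell_less by auto
  have f_measure: "measure \<nu> (f -` C) = measure \<mu> C" if C: "C \<in> sets borel" for C
  proof -
    have "measure \<nu> (f -` C) = (\<Sum>i<n. measure \<nu> (B i \<inter> F i -` C))"
      unfolding f_vimage using BF C disj
      by (intro Y.finite_measure_finite_Union) auto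
    also have "\<dots> = (\<Sum>i<n. measure \<mu> (part i \<inter> C))"
      using Q C by (intro sum.cong) (auto simp: Q_def)
    also have "\<dots> = measure \<mu> (\<Union>i<n. part i \<inter> C)"
      using C disj by (intro X.finite_measure_finite_Union[symmetric]) auto
    finally show ?thesis using part_UN[of C] by simp
  qed
  have f_mean: "(LINT y:f -` C|\<nu>. y) = (LINT x:C|\<mu>. x)" if C: "C \<in> sets borel" for C
  proof -
    have "(LINT y:f -` C|\<nu>. y) = (\<Sum>i<n. LINT y:B i \<inter> F i -` C|\<nu>. y)"
      unfolding f_vimage using BF C disj
      by (intro set_integral_finite_Union Y.set_integrable Y.integrable_id) auto
    also have "\<dots> = (\<Sum>i<n. LINT x:part i \<inter> C|\<mu>. x)"
      using Q C by (intro sum.cong) (auto simp: Q_def)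
    also have "\<dots> = (LINT x:(\<Union>i<n. part i \<inter> C)|\<mu>. x)"
      using C disj
      by (intro set_integral_finite_Union[symmetric] X.set_integrable X.integrable_id) auto
    finally show ?thesis using part_UN[of C] by simp
  qed
  have f_cell: "AE y in \<nu>. cell (f y) = b y"
  proof -
    have "AE y in \<nu>. y \<in> B i \<longrightarrow> cell (f y) = i" if i: "i < n" for i
    proof -
      \<comment> \<open>Transport with \<open>C = - part i\<close>: the points of \<open>B i\<close>
        sent outside \<open>part i\<close> have the mass of the empty set.\<close>
      let ?N = "B i \<inter> F i -` (- part i)"
      have "measure \<nu> ?N = 0"
        using Q[OF i] part_sets[of i] by (simp add: Q_def)
      then have "AE y in \<nu>. y \<notin> ?N"
        using BF[OF i, of "- part i"] by (intro AE_not_in) (auto simp: null_sets_def Y.emeasure_eq_measure)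
      then show ?thesis
        by eventually_elim (auto simp: f_def B_def)
    qed
    then have "AE y in \<nu>. \<forall>i\<in>{..<n}. y \<in> B i \<longrightarrow> cell (f y) = i"
      by (intro AE_finite_allI) auto
    then show ?thesis
      by eventually_elim (use b(2) in \<open>auto simp: B_def\<close>)
  qed
  define \<pi>' where "\<pi>' = distr \<nu> borel (\<lambda>y. (f y, y))"
  have fy [measurable]: "(\<lambda>y. (f y, y)) \<in> \<nu> \<rightarrow>\<^sub>M borel"
    by (intro borel_measurable_Pair) auto
  interpret \<nu>: prob_space \<nu> using \<nu> by (simp add: borel_prob_fm_def)
  interpret C: coupling \<mu> \<nu> \<pi>'
  proof (rule coupling.intro)
    show "prob_space \<pi>'"
      unfolding \<pi>'_def by (rule \<nu>.prob_space_distr[OF fy])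
    show "sets \<pi>' = sets borel" by (simp add: \<pi>'_def)
    show "distr \<pi>' borel fst = \<mu>"
    proof (rule measure_eqI)
      fix C assume "C \<in> sets (distr \<pi>' borel fst)"
      then have C: "C \<in> sets borel" by simp
      have "emeasure (distr \<pi>' borel fst) C = emeasure \<nu> (f -` C)"
        unfolding \<pi>'_def using C by (simp add: distr_distr comp_def emeasure_distr)
      then show "emeasure (distr \<pi>' borel fst) C = emeasure \<mu> C"
        using f_measure[OF C] by (simp add: Y.emeasure_eq_measure X.emeasure_eq_measure)
    qed simp
    show "distr \<pi>' borel snd = \<nu>"
      unfolding \<pi>'_def by (simp add: distr_distr comp_def distr_id2)
  qed (rule \<mu> \<nu>)+
  have "martingale_coupling \<mu> \<nu> \<pi>'"
  proof (intro martingale_coupling.intro C.coupling_axioms martingale_coupling_axioms.intro)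
    fix A :: "real set" assume A: "A \<in> sets borel"
    have fA: "f -` A \<in> sets borel" using measurable_sets[OF f A] by simp
    have "(LINT z:fst -` A|\<pi>'. snd z) = (LINT y:f -` A|\<nu>. y)"
      unfolding set_lebesgue_integral_def \<pi>'_def
      using A C.vimage_fst_sets[OF A] by (subst integral_distr) (auto simp: indicator_def C.sets_\<pi>)
    also have "\<dots> = (LINT x:A|\<mu>. x)" by (rule f_mean[OF A])
    also have "\<dots> = (LINT z:fst -` A|\<pi>'. fst z)"
      by (intro C.set_integral_fst[symmetric] A) auto
    finally show "(LINT z:fst -` A|\<pi>'. snd z) = (LINT z:fst -` A|\<pi>'. fst z)" .
  qed
  then have "\<pi>' \<in> martingale_transports \<mu> \<nu>"
    using martingale_transports_iff[OF \<mu> \<nu>] by blast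
  then have "\<pi>' \<in> monge_martingale_transports \<mu> \<nu>"
    using f by (auto simp: monge_martingale_transports_def \<pi>'_def)
  moreover have "measure \<pi>' (fst -` part i \<inter> snd -` part j) = measure \<pi> (fst -` part i \<inter> snd -` part j)"
    for i j
  proof (cases "i < n")
    case True
    have S: "fst -` part i \<inter> snd -` part j \<in> sets (borel :: (real \<times> real) measure)"
      using vimage_fst_sets[OF part_sets] vimage_snd_sets[OF part_sets] by (auto simp: sets_\<pi>)
    have "measure \<pi>' (fst -` part i \<inter> snd -` part j) = measure \<nu> {y. cell (f y) = i \<and> cell y = j}"
      unfolding \<pi>'_def using S by (subst measure_distr) (auto intro!: arg_cong2[where f=measure])
    also have "\<dots> = measure \<nu> ({y. b y = i} \<inter> part j)"
    proof (rule measure_eq_AE)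
      show "AE y in \<nu>. (y \<in> {y. cell (f y) = i \<and> cell y = j}) = (y \<in> {y. b y = i} \<inter> part j)"
        using f_cell by eventually_elim auto
      have "{y. cell (f y) = i \<and> cell y = j} = f -` part i \<inter> part j" by auto
      then show "{y. cell (f y) = i \<and> cell y = j} \<in> sets \<nu>"
        using measurable_sets[OF f part_sets, of i] by auto
    qed (use B[of i] in \<open>auto simp: B_def\<close>)
    finally show ?thesis using mass[OF True] by simp
  next
    case False
    then have "part i = {}" using cell_less by fastforce
    then show ?thesis by simp
  qed
  ultimately show thesis using that by blast
qed

end

section \<open>Approximation of the cost\<close>

text \<open>Dominated convergence. With \<open>g = f\<close> it truncates an integrable bound; with
  \<open>f = 1\<close> and the identity for \<open>g\<close> it is tightness.\<close>

lemma tail_integral_tendsto_0: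
  fixes f g :: "'a \<Rightarrow> real"
  assumes f: "integrable M f" and [measurable]: "g \<in> borel_measurable M"
  shows "(\<lambda>k. \<integral>x. (if real k < \<bar>g x\<bar> then \<bar>f x\<bar> else 0) \<partial>M) \<longlonglongrightarrow> 0"
proof -
  have [measurable]: "f \<in> borel_measurable M" using f by auto
  have "(\<lambda>k. \<integral>x. (if real k < \<bar>g x\<bar> then \<bar>f x\<bar> else 0) \<partial>M) \<longlonglongrightarrow> (\<integral>x. 0 \<partial>M)"
  proof (rule integral_dominated_convergence[where w="\<lambda>x. \<bar>f x\<bar>"])
    show "AE x in M. (\<lambda>k. if real k < \<bar>g x\<bar> then \<bar>f x\<bar> else 0) \<longlonglongrightarrow> 0"
    proof (rule AE_I2)
      fix x
      obtain K where "\<bar>g x\<bar> \<le> real K" using real_arch_simple by blast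
      then have "\<forall>\<^sub>F k in sequentially. (if real k < \<bar>g x\<bar> then \<bar>f x\<bar> else 0) = 0"
        by (intro eventually_mono[OF eventually_ge_at_top[of K]]) auto
      then show "(\<lambda>k. if real k < \<bar>g x\<bar> then \<bar>f x\<bar> else 0) \<longlonglongrightarrow> 0"
        by (rule tendsto_eventually)
    qed
    show "integrable M (\<lambda>x. \<bar>f x\<bar>)" using f by auto
  qed auto
  then show ?thesis by simp
qed

text \<open>A cost that is constant on rectangles sees a coupling only through the rectangle masses,
  the quantities that \<open>monge_transport_exists\<close> preserves.\<close>

lemma (in coupling) cell_function:
  fixes cell :: "real \<Rightarrow> nat" and s :: "nat \<Rightarrow> nat \<Rightarrow> real"
  assumes "mono cell" and less: "\<And>x. cell x < n"
  defines "S \<equiv> \<lambda>i j. fst -` {x. cell x = i} \<inter> snd -` {x. cell x = j}"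
  shows integrable_cell_function: "integrable \<pi> (\<lambda>z. s (cell (fst z)) (cell (snd z)))"
    and integral_cell_function:
      "(\<integral>z. s (cell (fst z)) (cell (snd z)) \<partial>\<pi>) = (\<Sum>i<n. \<Sum>j<n. s i j * measure \<pi> (S i j))"
proof -
  have "{x. cell x = i} \<in> sets borel" for i
    using measurable_sets[OF mono_nat_measurable[OF \<open>mono cell\<close>], of "{i}"] by (simp add: vimage_def)
  then have S: "S i j \<in> sets \<pi>" for i j
    unfolding S_def by (intro sets.Int vimage_fst_sets vimage_snd_sets)
  have eq: "s (cell (fst z)) (cell (snd z)) = (\<Sum>i<n. \<Sum>j<n. s i j * indicat_real (S i j) z)" for z
  proof -
    have "(\<Sum>i<n. \<Sum>j<n. s i j * indicat_real (S i j) z) =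
        (\<Sum>i<n. if i = cell (fst z) then \<Sum>j<n. if j = cell (snd z) then s i j else 0 else 0)"
      by (intro sum.cong refl) (auto simp: S_def indicator_def intro!: sum.cong sum.neutral)
    then show ?thesis using less by simp
  qed
  have int: "integrable \<pi> (\<lambda>z. s i j * indicat_real (S i j) z)" for i j
    using S by (intro integrable_mult_right integrable_real_indicator) (auto simp: less_top[symmetric])
  show "integrable \<pi> (\<lambda>z. s (cell (fst z)) (cell (snd z)))"
    unfolding eq using int by (intro Bochner_Integration.integrable_sum)
  show "(\<integral>z. s (cell (fst z)) (cell (snd z)) \<partial>\<pi>) = (\<Sum>i<n. \<Sum>j<n. s i j * measure \<pi> (S i j))"
  proof -
    have "(\<integral>z. (\<Sum>i<n. \<Sum>j<n. s i j * indicat_real (S i j) z) \<partial>\<pi>) =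
        (\<Sum>i<n. \<integral>z. (\<Sum>j<n. s i j * indicat_real (S i j) z) \<partial>\<pi>)"
      by (intro Bochner_Integration.integral_sum Bochner_Integration.integrable_sum int)
    also have "\<dots> = (\<Sum>i<n. \<Sum>j<n. \<integral>z. s i j * indicat_real (S i j) z \<partial>\<pi>)"
      by (intro sum.cong refl Bochner_Integration.integral_sum int)
    finally show ?thesis unfolding eq by simp
  qed
qed

lemma grid_cells_exist:
  fixes R d :: real
  assumes "0 \<le> R" "0 < d"
  obtains cell :: "real \<Rightarrow> nat" and n where "mono cell" "\<And>x. cell x < n"
    "\<And>x x'. \<bar>x\<bar> \<le> R \<Longrightarrow> cell x' = cell x \<Longrightarrow> \<bar>x'\<bar> \<le> R \<and> \<bar>x' - x\<bar> < d"
proof -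
  define m where "m x = nat \<lfloor>(x + R) / d\<rfloor>" for x
  have m_mono: "m x \<le> m y" if "x \<le> y" for x y
    unfolding m_def using that assms by (intro nat_mono floor_mono divide_right_mono) auto
  \<comment> \<open>The first and the last index collect the two tails, so no cell meets both
    \<open>{- R..R}\<close> and its complement.\<close>
  define cell where "cell x = (if x < - R then 0 else if x \<le> R then Suc (m x) else Suc (Suc (m R)))" for x
  show thesis
  proof
    show "mono cell"
      using m_mono by (auto simp: mono_def cell_def le_SucI)
    show "cell x < Suc (Suc (Suc (m R)))" for x
      using m_mono[of x R] by (auto simp: cell_def)
    fix x x' assume x: "\<bar>x\<bar> \<le> R" and eq: "cell x' = cell x"
    have "cell x = Suc (m x)" using x by (auto simp: cell_def)
    then have x': "\<bar>x'\<bar> \<le> R" "m x' = m x"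
      using eq m_mono[of x R] x by (auto simp: cell_def split: if_splits)
    have "0 \<le> (x + R) / d" "0 \<le> (x' + R) / d"
      using x x' assms by auto
    with x'(2) have "\<lfloor>(x' + R) / d\<rfloor> = \<lfloor>(x + R) / d\<rfloor>"
      by (simp add: m_def eq_nat_nat_iff)
    then have "\<bar>(x' + R) / d - (x + R) / d\<bar> < 1" by linarith
    moreover have "(x' + R) / d - (x + R) / d = (x' - x) / d"
      by (simp add: diff_divide_distrib[symmetric])
    ultimately have "\<bar>x' - x\<bar> / d < 1"
      using assms by (simp add: abs_divide)
    then show "\<bar>x'\<bar> \<le> R \<and> \<bar>x' - x\<bar> < d" using assms x' by simp
  qed
qed

text \<open>The error is controlled by the marginals alone, hence uniformly over all couplings.\<close>

lemma cost_step_approximation: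
  fixes c :: "real \<times> real \<Rightarrow> real" and a b :: "real \<Rightarrow> real"
  assumes c: "continuous_on UNIV c" and a: "integrable \<mu> a" and b: "integrable \<nu> b"
    and bound: "\<And>x y. \<bar>c (x, y)\<bar> \<le> a x + b y" and \<mu>: "\<mu> \<in> borel_prob_fm" and \<nu>: "\<nu> \<in> borel_prob_fm"
    and e: "0 < e"
  obtains cell :: "real \<Rightarrow> nat" and n s where "mono cell" "\<And>x. cell x < n"
    "\<And>\<pi>. coupling \<mu> \<nu> \<pi> \<Longrightarrow> \<bar>(\<integral>z. c z \<partial>\<pi>) - (\<integral>z. s (cell (fst z)) (cell (snd z)) \<partial>\<pi>)\<bar> \<le> e"
proof -
  interpret X: finite_mean_measure \<mu> by (rule borel_prob_fm_finite_mean[OF \<mu>])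
  interpret Y: finite_mean_measure \<nu> by (rule borel_prob_fm_finite_mean[OF \<nu>])
  have [measurable]: "a \<in> borel_measurable borel" "b \<in> borel_measurable borel"
    using a b by auto
  \<comment> \<open>The error budget: \<open>e / 2\<close> from uniform continuity on the square,
    \<open>e / 8\<close> for each truncated bound, and \<open>e / 4\<close> for
    \<open>2 * real N\<close> times the tail masses of the two marginals.\<close>
  have "\<forall>\<^sub>F k in sequentially. (\<integral>x. (if real k < \<bar>a x\<bar> then \<bar>a x\<bar> else 0) \<partial>\<mu>) < e / 8"
    "\<forall>\<^sub>F k in sequentially. (\<integral>y. (if real k < \<bar>b y\<bar> then \<bar>b y\<bar> else 0) \<partial>\<nu>) < e / 8"
    using a b e by (intro order_tendstoD(2)[OF tail_integral_tendsto_0]; simp)+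
  then have "\<forall>\<^sub>F k in sequentially. (\<integral>x. (if real k < \<bar>a x\<bar> then \<bar>a x\<bar> else 0) \<partial>\<mu>) < e / 8 \<and>
      (\<integral>y. (if real k < \<bar>b y\<bar> then \<bar>b y\<bar> else 0) \<partial>\<nu>) < e / 8"
    by (rule eventually_conj)
  from eventually_happens'[OF sequentially_bot this] obtain N :: nat where
    N: "(\<integral>x. (if real N < \<bar>a x\<bar> then \<bar>a x\<bar> else 0) \<partial>\<mu>) < e / 8"
    "(\<integral>y. (if real N < \<bar>b y\<bar> then \<bar>b y\<bar> else 0) \<partial>\<nu>) < e / 8" by blast
  have "(\<lambda>k. 2 * real N * ((\<integral>x. (if real k < \<bar>x\<bar> then \<bar>1\<bar> else 0) \<partial>\<mu>) +
      (\<integral>y. (if real k < \<bar>y\<bar> then \<bar>1\<bar> else 0) \<partial>\<nu>))) \<longlonglongrightarrow> 2 * real N * (0 + 0)"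
    by (intro tendsto_intros tail_integral_tendsto_0) auto
  then have "\<forall>\<^sub>F k in sequentially. 2 * real N * ((\<integral>x. (if real k < \<bar>x\<bar> then \<bar>1\<bar> else 0) \<partial>\<mu>) +
      (\<integral>y. (if real k < \<bar>y\<bar> then \<bar>1\<bar> else 0) \<partial>\<nu>)) < e / 4"
    using e by (intro order_tendstoD(2)) auto
  from eventually_happens'[OF sequentially_bot this] obtain R :: nat where
    R: "2 * real N * ((\<integral>x. (if real R < \<bar>x\<bar> then 1 else 0) \<partial>\<mu>) +
      (\<integral>y. (if real R < \<bar>y\<bar> then 1 else 0) \<partial>\<nu>)) < e / 4" unfolding abs_one by blast
  define K where "K = {- real R..real R} \<times> {- real R..real R}"
  have "compact K" unfolding K_def by (intro compact_Times compact_Icc)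
  then have "uniformly_continuous_on K c"
    using c by (intro compact_uniformly_continuous continuous_on_subset[OF c]) auto
  then obtain d where d: "0 < d" "\<And>z z'. z \<in> K \<Longrightarrow> z' \<in> K \<Longrightarrow> dist z' z < d \<Longrightarrow> dist (c z') (c z) < e / 2"
    using e unfolding uniformly_continuous_on_def by (metis half_gt_zero)
  \<comment> \<open>Half of \<open>d\<close> per coordinate, because the distance in the plane is at
    most the sum of the coordinate distances.\<close>
  obtain cell :: "real \<Rightarrow> nat" and n where mono: "mono cell" and less: "\<And>x. cell x < n"
    and cell: "\<And>x x'. \<bar>x\<bar> \<le> real R \<Longrightarrow> cell x' = cell x \<Longrightarrow> \<bar>x'\<bar> \<le> real R \<and> \<bar>x' - x\<bar> < d / 2"
    by (rule grid_cells_exist[of "real R" "d / 2"]) (use d in auto)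
  define P where "P i j z \<longleftrightarrow> z \<in> K \<and> cell (fst z) = i \<and> cell (snd z) = j" for i j z
  \<comment> \<open>The cost at a chosen point of the rectangle, and 0 if the rectangle misses the
    square \<open>K\<close>. By the choice of the cells a rectangle that meets \<open>K\<close> lies
    inside it, so outside \<open>K\<close> the step cost vanishes.\<close>
  define s where "s i j = (if \<exists>z. P i j z then c (SOME z. P i j z) else 0)" for i j
  define A where "A x = (if real N < \<bar>a x\<bar> then \<bar>a x\<bar> else 0)" for x
  define B where "B y = (if real N < \<bar>b y\<bar> then \<bar>b y\<bar> else 0)" for y
  define T where "T x = (if real R < \<bar>x\<bar> then 1 else 0 :: real)" for x
  have A: "integrable \<mu> A" and B: "integrable \<nu> B"
    unfolding A_def[abs_def] B_def[abs_def]
    using Bochner_Integration.integrable_bound[OF a, of "\<lambda>x. if real N < \<bar>a x\<bar> then \<bar>a x\<bar> else 0"]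
      Bochner_Integration.integrable_bound[OF b, of "\<lambda>x. if real N < \<bar>b x\<bar> then \<bar>b x\<bar> else 0"] by auto
  have T: "integrable \<mu> T" "integrable \<nu> T"
    unfolding T_def[abs_def]
    by (intro X.integrable_const_bound[of _ 1] Y.integrable_const_bound[of _ 1]; simp)+
  have meas: "A \<in> borel_measurable borel" "B \<in> borel_measurable borel" "T \<in> borel_measurable borel"
    using A B T by auto
  have pointwise: "\<bar>c z - s (cell (fst z)) (cell (snd z))\<bar> \<le>
      e / 2 + A (fst z) + B (snd z) + 2 * real N * (T (fst z) + T (snd z))" for z
  proof -
    have nonneg: "0 \<le> A (fst z)" "0 \<le> B (snd z)" "0 \<le> T (fst z)" "0 \<le> T (snd z)"
      by (auto simp: A_def B_def T_def)
    show ?thesis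
    proof (cases "z \<in> K")
      case True
      define w where "w = (SOME w. P (cell (fst z)) (cell (snd z)) w)"
      have ex: "\<exists>w. P (cell (fst z)) (cell (snd z)) w"
        using True by (intro exI[of _ z]) (simp add: P_def)
      from someI_ex[OF this] have w: "w \<in> K" "cell (fst w) = cell (fst z)" "cell (snd w) = cell (snd z)"
        unfolding w_def[symmetric] by (auto simp: P_def)
      have "\<bar>fst w - fst z\<bar> < d / 2" "\<bar>snd w - snd z\<bar> < d / 2"
        using cell[OF _ w(2)] cell[OF _ w(3)] True by (auto simp: K_def mem_Times_iff abs_le_iff)
      then have "dist w z < d"
        using sqrt_sum_squares_le_sum_abs[of "fst w - fst z" "snd w - snd z"]
        by (simp add: dist_prod_def dist_real_def)
      then have "\<bar>c w - c z\<bar> < e / 2"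
        using d(2)[OF True w(1)] by (simp add: dist_real_def)
      moreover have "s (cell (fst z)) (cell (snd z)) = c w"
        using ex by (simp add: s_def w_def)
      moreover have "0 \<le> 2 * real N * (T (fst z) + T (snd z))"
        using nonneg by simp
      ultimately show ?thesis using nonneg by linarith
    next
      case False
      have "\<not> P (cell (fst z)) (cell (snd z)) w" for w
      proof
        assume w: "P (cell (fst z)) (cell (snd z)) w"
        then have "\<bar>fst w\<bar> \<le> real R" "\<bar>snd w\<bar> \<le> real R"
          by (auto simp: P_def K_def mem_Times_iff abs_le_iff)
        with w have "\<bar>fst z\<bar> \<le> real R" "\<bar>snd z\<bar> \<le> real R"
          using cell[of "fst w" "fst z"] cell[of "snd w" "snd z"] by (auto simp: P_def)
        with False show False by (auto simp: K_def mem_Times_iff abs_le_iff)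
      qed
      then have "s (cell (fst z)) (cell (snd z)) = 0" by (simp add: s_def)
      moreover have "\<bar>c z\<bar> \<le> a (fst z) + b (snd z)"
        using bound[of "fst z" "snd z"] by simp
      moreover have "a (fst z) \<le> A (fst z) + real N" "b (snd z) \<le> B (snd z) + real N"
        by (auto simp: A_def B_def)
      moreover have "1 \<le> T (fst z) + T (snd z)"
        using False by (auto simp: T_def K_def mem_Times_iff abs_le_iff)
      then have "2 * real N * 1 \<le> 2 * real N * (T (fst z) + T (snd z))"
        by (intro mult_left_mono) auto
      ultimately show ?thesis using e by linarith
    qed
  qed
  show thesis
  proof (rule that[OF mono less])
    fix \<pi> assume "coupling \<mu> \<nu> \<pi>"
    then interpret coupling \<mu> \<nu> \<pi> .
    let ?s = "\<lambda>z. s (cell (fst z)) (cell (snd z))"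
    let ?g = "\<lambda>z. e / 2 + A (fst z) + B (snd z) + 2 * real N * (T (fst z) + T (snd z))"
    have int: "integrable \<pi> (\<lambda>z. A (fst z))" "integrable \<pi> (\<lambda>z. B (snd z))"
      "integrable \<pi> (\<lambda>z. T (fst z))" "integrable \<pi> (\<lambda>z. T (snd z))"
      using A B T by (auto intro: integrable_fst integrable_snd)
    have s: "integrable \<pi> ?s"
      by (rule integrable_cell_function[OF mono less])
    have "integrable \<pi> (\<lambda>z. a (fst z) + b (snd z))"
      using a b by (auto intro: integrable_fst integrable_snd)
    then have c_int: "integrable \<pi> c"
    proof (rule Bochner_Integration.integrable_bound)
      show "c \<in> borel_measurable \<pi>"
        using borel_measurable_continuous_onI[OF c] by simp
      show "AE z in \<pi>. norm (c z) \<le> norm (a (fst z) + b (snd z))"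
        using bound by (intro AE_I2) (metis abs_ge_self order_trans prod.collapse real_norm_def)
    qed
    have "\<bar>(\<integral>z. c z \<partial>\<pi>) - (\<integral>z. ?s z \<partial>\<pi>)\<bar> = \<bar>\<integral>z. c z - ?s z \<partial>\<pi>\<bar>"
      using c_int s by simp
    also have "\<dots> \<le> (\<integral>z. \<bar>c z - ?s z\<bar> \<partial>\<pi>)"
      by (rule integral_abs_bound)
    also have "\<dots> \<le> (\<integral>z. ?g z \<partial>\<pi>)"
      using c_int s int pointwise by (intro integral_mono) auto
    also have "\<dots> = e / 2 + (\<integral>z. A (fst z) \<partial>\<pi>) + (\<integral>z. B (snd z) \<partial>\<pi>) +
        2 * real N * ((\<integral>z. T (fst z) \<partial>\<pi>) + (\<integral>z. T (snd z) \<partial>\<pi>))"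
      using int prob_space by simp
    also have "\<dots> = e / 2 + (\<integral>x. A x \<partial>\<mu>) + (\<integral>y. B y \<partial>\<nu>) +
        2 * real N * ((\<integral>x. T x \<partial>\<mu>) + (\<integral>y. T y \<partial>\<nu>))"
      using meas by (simp add: integral_fst integral_snd)
    also have "\<dots> \<le> e"
      using N R unfolding A_def B_def T_def by linarith
    finally show "\<bar>(\<integral>z. c z \<partial>\<pi>) - (\<integral>z. ?s z \<partial>\<pi>)\<bar> \<le> e" .
  qed
qed

theorem corollary2p4:
  fixes \<mu> \<nu> :: "real measure" and c :: "real \<times> real \<Rightarrow> real" and a b :: "real \<Rightarrow> real"
  assumes "\<mu> \<in> borel_prob_fm" and "\<nu> \<in> borel_prob_fm"
    and "\<mu> \<le>\<^sub>c\<^sub>x \<nu>"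
    and "atomless \<nu>"
    and "continuous_on UNIV c"
    and "integrable \<mu> a" and "integrable \<nu> b"
    and "\<And>x y. \<bar>c (x, y)\<bar> \<le> a x + b y"
  shows "(INF \<pi> \<in> monge_martingale_transports \<mu> \<nu>. ereal (\<integral>z. c z \<partial>\<pi>)) =
         (INF \<pi> \<in> martingale_transports \<mu> \<nu>. ereal (\<integral>z. c z \<partial>\<pi>))"
proof (rule antisym)
  show "(INF \<pi> \<in> martingale_transports \<mu> \<nu>. ereal (\<integral>z. c z \<partial>\<pi>)) \<le>
      (INF \<pi> \<in> monge_martingale_transports \<mu> \<nu>. ereal (\<integral>z. c z \<partial>\<pi>))"
    by (intro INF_superset_mono) (auto simp: monge_martingale_transports_def)
  show "(INF \<pi> \<in> monge_martingale_transports \<mu> \<nu>. ereal (\<integral>z. c z \<partial>\<pi>)) \<le>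
      (INF \<pi> \<in> martingale_transports \<mu> \<nu>. ereal (\<integral>z. c z \<partial>\<pi>))"
  proof (rule INF_greatest)
    fix \<pi> assume "\<pi> \<in> martingale_transports \<mu> \<nu>"
    then interpret martingale_coupling \<mu> \<nu> \<pi>
      using martingale_transports_iff assms by blast
    show "(INF \<pi> \<in> monge_martingale_transports \<mu> \<nu>. ereal (\<integral>z. c z \<partial>\<pi>)) \<le> ereal (\<integral>z. c z \<partial>\<pi>)"
    proof (rule ereal_le_epsilon2)
      fix e :: real assume "0 < e"
      then have "0 < e / 2" by simp
      \<comment> \<open>The step cost is fixed before the Monge transport is chosen, which is
        possible because the approximation is uniform over couplings. It is used once for \<pi> and
        once for its replacement, hence \<open>e / 2\<close>.\<close>
      obtain cell :: "real \<Rightarrow> nat" and n s where mono: "mono cell" and less: "\<And>x. cell x < n"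
        and approx: "\<And>\<rho>. coupling \<mu> \<nu> \<rho> \<Longrightarrow>
          \<bar>(\<integral>z. c z \<partial>\<rho>) - (\<integral>z. s (cell (fst z)) (cell (snd z)) \<partial>\<rho>)\<bar> \<le> e / 2"
        by (rule cost_step_approximation[OF assms(5-8) assms(1,2) \<open>0 < e / 2\<close>]) blast
      interpret gridded_coupling \<mu> \<nu> \<pi> cell n
        using mono less assms(4) by unfold_locales
      obtain \<pi>' where \<pi>': "\<pi>' \<in> monge_martingale_transports \<mu> \<nu>"
        and eq: "\<And>i j. measure \<pi>' (fst -` part i \<inter> snd -` part j) =
          measure \<pi> (fst -` part i \<inter> snd -` part j)"
        by (rule monge_transport_exists) blast
      interpret \<pi>': martingale_coupling \<mu> \<nu> \<pi>'
        using martingale_transports_iff assms \<pi>' by (auto simp: monge_martingale_transports_def)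
      have "(\<integral>z. s (cell (fst z)) (cell (snd z)) \<partial>\<pi>') = (\<integral>z. s (cell (fst z)) (cell (snd z)) \<partial>\<pi>)"
        unfolding integral_cell_function[OF mono less] \<pi>'.integral_cell_function[OF mono less] eq ..
      then have "(\<integral>z. c z \<partial>\<pi>') \<le> (\<integral>z. c z \<partial>\<pi>) + e"
        using approx[OF coupling_axioms] approx[OF \<pi>'.coupling_axioms] by linarith
      then have "ereal (\<integral>z. c z \<partial>\<pi>') \<le> ereal (\<integral>z. c z \<partial>\<pi>) + ereal e" by simp
      with INF_lower[OF \<pi>', of "\<lambda>\<pi>. ereal (\<integral>z. c z \<partial>\<pi>)"]
      show "(INF \<pi> \<in> monge_martingale_transports \<mu> \<nu>. ereal (\<integral>z. c z \<partial>\<pi>)) \<le>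
          ereal (\<integral>z. c z \<partial>\<pi>) + ereal e"
        by (rule order_trans)
    qed
  qed
qed

end
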